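(* Let $\beta>0$ and let $\tau$ be a recurrent renewal (with $\mathbf P(\tau_1=n)=L(n)/n^{1+\alpha}$, $\alpha>0$, $L$ slowly varying) such that $$Z_\infty^{\beta,\omega}>0\quad\mathbb P\text{-a.s.}$$ Then for all $\gamma<\alpha$, $$\lim_{N\to\infty}\mathbb E\Big[\mathbf P_N^{\beta,-\lambda(\beta),\omega}\big(|\tau\cap[1,N]|>N^\gamma\big)\Big]=1 .$$
   Context: Renewal process. Under the law $\mathbf P$ (expectation $\mathbf E$), $\tau=(\tau_n)_{n\ge 0}$ is a renewal sequence: $\tau_0=0$ and the increments $\tau_{n+1}-\tau_n$ are i.i.d. with values in $\{1,2,\dots\}$ and law $\mathbf P(\tau_1=n)=L(n)/n^{1+\alpha}$, $n\ge1$, where $\alpha>0$ and $L:(0,\infty)\to(0,\infty)$ is slowly varying, i.e. measurable with $\lim_{x\to\infty}L(xu)/L(x)=1$ for all $u>0$. Recurrent means $\sum_{n\ge1}\mathbf P(\tau_1=n)=1$. $\tau$ is also viewed as the random subset $\{\tau_k:k\ge0\}$ of $\{0,1,2,\dots\}$. Environment. $\omega=(\omega_n)_{n\ge1}$ is a sequence of i.i.d. real random variables (law $\mathbb P$, expectation $\mathbb E$), independent of $\tau$, with mean $0$, variance $1$ and exponential moments: $\lambda(\beta):=\log\mathbb E[\exp(\beta\omega_1)]<\infty$ for all $\beta\ge 0$. Model. For $\beta\ge0$, $h\in\mathbb R$, $N\ge1$, the pinning measure $\mathbf P_N^{\beta,h,\omega}$ on $\tau$ is defined by $$\frac{\mathrm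 d\mathbf P_N^{\beta,h,\omega}}{\mathrm d\mathbf P}(\tau):=\frac1{Z_N^{\beta,h,\omega}}\exp\Big(\sum_{n=1}^N(h+\beta\omega_n)\mathbf 1_{\{n\in\tau\}}\Big),\qquad Z_N^{\beta,h,\omega}:=\mathbf E\Big[\exp\Big(\sum_{n=1}^N(h+\beta\omega_n)\mathbf 1_{\{n\in\tau\}}\Big)\Big].$$ At $h=-\lambda(\beta)$, the sequence $\big(Z_N^{\beta,-\lambda(\beta),\omega}\big)_{N\ge1}$ is a non-negative martingale with respect to the filtration $\mathcal F_N:=\sigma(\omega_n,\,n\le N)$, and $Z_\infty^{\beta,\omega}:=\lim_{N\to\infty}Z_N^{\beta,-\lambda(\beta),\omega}$ denotes its $\mathbb P$-a.s. limit. *)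

theory Defs
  imports "HOL-Probability.Probability"
begin

definition slowly_varying :: "(real \<Rightarrow> real) \<Rightarrow> bool" where
  "slowly_varying L \<longleftrightarrow>
     L \<in> borel_measurable (restrict_space borel {0<..}) \<and>
     (\<forall>x>0. L x > 0) \<and>
     (\<forall>u>0. ((\<lambda>x. L (x * u) / L x) \<longlongrightarrow> 1) at_top)"

locale renewal_process = prob_space M
  for M :: "'a measure" +
  fixes \<tau> :: "nat \<Rightarrow> 'a \<Rightarrow> nat" and \<alpha> :: real and L :: "real \<Rightarrow> real"
  assumes tau_measurable: "\<And>k. \<tau> k \<in> measurable M (count_space UNIV)"
    and tau_0: "\<And>x. x \<in> space M \<Longrightarrow> \<tau> 0 x = 0"
    and tau_less: "\<And>k x. x \<in> space M \<Longrightarrow> \<tau> k x < \<tau> (Suc k) x"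
    and increments_indep:
      "indep_vars (\<lambda>_. count_space UNIV) (\<lambda>k x. \<tau> (Suc k) x - \<tau> k x) UNIV"
    and increments_identically_distributed:
      "\<And>k. distr M (count_space UNIV) (\<lambda>x. \<tau> (Suc k) x - \<tau> k x)
            = distr M (count_space UNIV) (\<lambda>x. \<tau> (Suc 0) x - \<tau> 0 x)"
    and alpha_pos: "\<alpha> > 0"
    and slowly_varying_L: "slowly_varying L"
    and tau_1_law:
      "\<And>n. n \<ge> 1 \<Longrightarrow> prob {x \<in> space M. \<tau> 1 x = n} = L (real n) / real n powr (1 + \<alpha>)"

definition recurrent_renewal :: "'a measure \<Rightarrow> (nat \<Rightarrow> 'a \<Rightarrow> nat) \<Rightarrow> bool" where
  "recurrent_renewal M \<tau> \<longleftrightarrow> (\<lambda>n. measure M {x \<in> space M. \<tau> 1 x = Suc n}) sums 1"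

text \<open>The variable at index 0 is not part of the environment and is left unconstrained.\<close>

locale environment = prob_space Q
  for Q :: "'b measure" +
  fixes \<omega> :: "nat \<Rightarrow> 'b \<Rightarrow> real"
  assumes omega_indep: "indep_vars (\<lambda>_. borel) \<omega> {1..}"
    and omega_identically_distributed:
      "\<And>n. n \<ge> 1 \<Longrightarrow> distr Q borel (\<omega> n) = distr Q borel (\<omega> 1)"
    and omega_integrable: "integrable Q (\<omega> 1)"
    and omega_mean: "expectation (\<omega> 1) = 0"
    and omega_variance: "variance (\<omega> 1) = 1"
    and omega_exp_moments: "\<And>\<beta>. \<beta> \<ge> 0 \<Longrightarrow> integrable Q (\<lambda>x. exp (\<beta> * \<omega> 1 x))"

definition log_mgf :: "'b measure \<Rightarrow> (nat \<Rightarrow> 'b \<Rightarrow> real) \<Rightarrow> real \<Rightarrow> real" where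
  "log_mgf Q \<omega> \<beta> = ln (\<integral>x. exp (\<beta> * \<omega> 1 x) \<partial>Q)"

definition renewal_set :: "(nat \<Rightarrow> 'a \<Rightarrow> nat) \<Rightarrow> 'a \<Rightarrow> nat set" where
  "renewal_set \<tau> y = range (\<lambda>k. \<tau> k y)"

text \<open>
  In the next three definitions \<open>w\<close> is one fixed realization of the environment. The
  renewal and the environment live on separate probability spaces, so that integrating
  over the renewal with \<open>w\<close> fixed, and then over \<open>w\<close>, is integration over their product;
  this is how the independence of the two is expressed.
\<close>

definition pinning_weight ::
  "(nat \<Rightarrow> 'a \<Rightarrow> nat) \<Rightarrow> nat \<Rightarrow> real \<Rightarrow> real \<Rightarrow> (nat \<Rightarrow> real) \<Rightarrow> 'a \<Rightarrow> real" where
  "pinning_weight \<tau> N \<beta> h w y =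
     exp (\<Sum>n=1..N. (h + \<beta> * w n) * indicator (renewal_set \<tau> y) n)"

definition partition_function ::
  "'a measure \<Rightarrow> (nat \<Rightarrow> 'a \<Rightarrow> nat) \<Rightarrow> nat \<Rightarrow> real \<Rightarrow> real \<Rightarrow> (nat \<Rightarrow> real) \<Rightarrow> real" where
  "partition_function M \<tau> N \<beta> h w = (\<integral>y. pinning_weight \<tau> N \<beta> h w y \<partial>M)"

definition pinning_measure ::
  "'a measure \<Rightarrow> (nat \<Rightarrow> 'a \<Rightarrow> nat) \<Rightarrow> nat \<Rightarrow> real \<Rightarrow> real \<Rightarrow> (nat \<Rightarrow> real) \<Rightarrow> 'a measure" where
  "pinning_measure M \<tau> N \<beta> h w =
     density M (\<lambda>y. ennreal (pinning_weight \<tau> N \<beta> h w y / partition_function M \<tau> N \<beta> h w))"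

text \<open>
  The limit exists almost surely by martingale convergence; on the exceptional null set
  the value of \<open>lim\<close> is unspecified.
\<close>

definition limit_partition_function ::
  "'a measure \<Rightarrow> (nat \<Rightarrow> 'a \<Rightarrow> nat) \<Rightarrow> 'b measure \<Rightarrow> (nat \<Rightarrow> 'b \<Rightarrow> real) \<Rightarrow> real \<Rightarrow> 'b \<Rightarrow> real" where
  "limit_partition_function M \<tau> Q \<omega> \<beta> x =
     lim (\<lambda>N. partition_function M \<tau> N \<beta> (- log_mgf Q \<omega> \<beta>) (\<lambda>n. \<omega> n x))"

end

theory Submission
  imports Defs
begin

text \<open>
  Write $h_n$ for $\exp(\beta\omega_n - \lambda(\beta))$ (\<open>tilt\<close> below), a positive variable of
  mean one. At the critical value of the pinning parameter a trajectory has weight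
  $\prod_{n} h_n$ over its contacts $n \in \tau \cap [1,N]$, so averaging over the environment
  turns the weight of any event about the contacts back into its probability under the free
  renewal. The pinning probability of having at most $N^\gamma$ contacts is a quotient
  $B_N / Z_N$ in which $B_N$ has mean $P(|\tau \cap [1,N]| \le N^\gamma)$, so it is small on
  average when two things hold: few contacts are unlikely for the free renewal, and $Z_N$ does
  not come close to zero.
  
  The first point (\<open>few_contacts_unlikely\<close>) is a moment bound. Having fewer than $k$ contacts
  means $\tau_k > N$. For $a \le 1$ with $a < \alpha$ the gaps have a finite moment of order $a$,
  because a slowly varying function grows more slowly than any power
  (\<open>slowly_varying_le_powr\<close>), and subadditivity of $x \mapsto x^a$ gives
  $E[\tau_k^a] \le k E[\tau_1^a]$. Markov's inequality with $k \approx N^\gamma$ then yields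
  a bound of order $N^{\gamma - a}$, which is useful for $\gamma < \min(\alpha, 1)$.
  
  The second point uses that $Z_N$ is a nonnegative martingale and therefore converges almost
  surely (\<open>nonneg_supermartingale.AE_convergent\<close>, by counting upcrossings). The limit is positive
  by hypothesis, and convergence transfers this to a lower bound on $Z_N$ for large $N$
  (\<open>many_contacts\<close>).
  
  What remains is $\gamma \ge 1$, possible only for $\alpha > 1$, where the conclusion would be
  absurd since there are at most $N$ contacts. Positivity of the limit excludes this case:
  for $\alpha > 1/2$ and $\beta > 0$ the limit vanishes (\<open>strong_disorder\<close>). The reason is that
  at a contact a bounded score of $\omega_n$ has a mean larger by a fixed amount $\delta > 0$.
  Multiplying each site by a penalty with strength $s = N^{-1/2}$ in that score changes the law
  of the environment only by a bounded amount, because $N s^2 = 1$, but reduces the mean of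
  $Z_N$ to $E[(1 - s\delta)^{|\tau \cap [1,N]|}]$, which tends to zero as soon as there are
  typically $N^\eta$ contacts with $\eta > 1/2$. Consequently $Z_N$ tends to zero in
  probability.
\<close>

section \<open>Almost sure convergence of nonnegative supermartingales\<close>

text \<open>
  An investor buys when the path is below \<open>a\<close> and sells when it has reached \<open>b\<close>; \<open>holding\<close> says
  whether the asset is owned at the given time, so each completed trade is one upcrossing.
\<close>

primrec holding :: "(nat \<Rightarrow> real) \<Rightarrow> real \<Rightarrow> real \<Rightarrow> nat \<Rightarrow> bool" where
  "holding z a b 0 \<longleftrightarrow> z 0 < a"
| "holding z a b (Suc n) \<longleftrightarrow> z (Suc n) < (if holding z a b n then b else a)"

primrec upcrossings :: "(nat \<Rightarrow> real) \<Rightarrow> real \<Rightarrow> real \<Rightarrow> nat \<Rightarrow> nat" where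
  "upcrossings z a b 0 = 0"
| "upcrossings z a b (Suc n) =
     upcrossings z a b n + (if holding z a b n \<and> b \<le> z (Suc n) then 1 else 0)"

text \<open>
  The sum is the wealth of the investor. Each completed trade earns at least \<open>b - a\<close>, and the
  last summand on the left is the value of a trade that is still open.
\<close>

lemma upcrossing_gain:
  assumes "a \<le> b"
  shows "(b - a) * upcrossings z a b n + (if holding z a b n then z n - a else 0)
         \<le> (\<Sum>i<n. if holding z a b i then z (Suc i) - z i else 0)"
proof (induction n)
  case 0
  then show ?case by simp
next
  case (Suc n)
  show ?case
  proof (cases "holding z a b n")
    case True
    then show ?thesis using Suc assms by (auto simp: algebra_simps)
  next
    case False
    then show ?thesis using Suc assms by (auto simp: algebra_simps)
  qed
qed

lemma upcrossings_mono: "m \<le> n \<Longrightarrow> upcrossings z a b m \<le> upcrossings z a b n"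
  by (induction rule: dec_induct) auto

lemma upcrossings_increase:
  assumes "holding z a b m" "m < m'" "b \<le> z m'"
  shows "\<exists>j>m. Suc (upcrossings z a b m) \<le> upcrossings z a b j"
  using assms
proof (induction "m' - m" arbitrary: m)
  case 0
  then show ?case by simp
next
  case (Suc d)
  show ?case
  proof (cases "b \<le> z (Suc m)")
    case True
    then show ?thesis using Suc by (intro exI[of _ "Suc m"]) auto
  next
    case False
    then have h: "holding z a b (Suc m)" using Suc by simp
    have "Suc m < m'" using False Suc by (metis Suc_lessI)
    then obtain j where "j > Suc m" "Suc (upcrossings z a b (Suc m)) \<le> upcrossings z a b j"
      using Suc.hyps(1)[of "Suc m"] Suc.hyps(2) Suc.prems h by force
    then show ?thesis using upcrossings_mono[of m "Suc m" z a b] by (intro exI[of _ j]) auto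
  qed
qed

lemma upcrossings_unbounded:
  assumes "a \<le> b" "\<exists>\<^sub>F n in sequentially. z n < a" "\<exists>\<^sub>F n in sequentially. b \<le> z n"
  shows "\<exists>n. k \<le> upcrossings z a b n"
proof (induction k)
  case 0
  then show ?case by simp
next
  case (Suc k)
  then obtain n where n: "k \<le> upcrossings z a b n" by auto
  obtain m where m: "m > n" "z m < a"
    using assms(2) by (auto simp: frequently_sequentially) (metis Suc_le_lessD)
  obtain m' where m': "m' > m" "b \<le> z m'"
    using assms(3) by (auto simp: frequently_sequentially) (metis Suc_le_lessD)
  have h: "holding z a b m" using m assms by (cases m) auto
  from upcrossings_increase[OF h m'] obtain j where "Suc (upcrossings z a b m) \<le> upcrossings z a b j"
    by auto
  moreover have "k \<le> upcrossings z a b m" using n m upcrossings_mono[of n m z a b] by simp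
  ultimately show ?case by (intro exI[of _ j]) auto
qed

text \<open>
  The supermartingale inequality is stated through integrals over events of the past, so
  no conditional expectations occur.
\<close>

locale nonneg_supermartingale = prob_space M for M :: "'a measure" +
  fixes F :: "nat \<Rightarrow> 'a measure" and Z :: "nat \<Rightarrow> 'a \<Rightarrow> real"
  assumes subalg: "\<And>n. subalgebra M (F n)"
    and filtration: "\<And>n. sets (F n) \<subseteq> sets (F (Suc n))"
    and adapted: "\<And>n. Z n \<in> borel_measurable (F n)"
    and integrable: "\<And>n. integrable M (Z n)"
    and nonneg: "\<And>n x. x \<in> space M \<Longrightarrow> 0 \<le> Z n x"
    and decreasing: "\<And>n A. A \<in> sets (F n) \<Longrightarrow>
          (\<integral>x. indicator A x * Z (Suc n) x \<partial>M) \<le> (\<integral>x. indicator A x * Z n x \<partial>M)"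
begin

lemma space_F [simp]: "space (F n) = space M"
  using subalg by (auto simp: subalgebra_def)

lemma holding_measurable [measurable]:
  "Measurable.pred (F n) (\<lambda>x. holding (\<lambda>i. Z i x) a b n)"
proof (induction n)
  case 0
  note adapted[measurable]
  show ?case by simp
next
  case (Suc n)
  note adapted[measurable]
  have [measurable]: "Measurable.pred (F (Suc n)) (\<lambda>x. holding (\<lambda>i. Z i x) a b n)"
    using Suc filtration[of n] by (auto simp: pred_def)
  show ?case by simp
qed

lemma holding_measurable_M [measurable]:
  "Measurable.pred M (\<lambda>x. holding (\<lambda>i. Z i x) a b n)"
  using holding_measurable[where a=a and b=b and n=n] subalg[of n] by (auto simp: pred_def subalgebra_def)

lemma Z_measurable [measurable]: "Z n \<in> borel_measurable M"
  using adapted subalg measurable_from_subalg by blast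

lemma upcrossings_measurable [measurable]:
  "(\<lambda>x. upcrossings (\<lambda>i. Z i x) a b n) \<in> measurable M (count_space UNIV)"
  by (induction n) simp_all

text \<open>
  Trading a supermartingale with a strategy that only looks at the past cannot have positive
  expected wealth. A nonnegative path limits the loss of the open trade to \<open>a\<close>, so the expected
  gain from completed trades is at most \<open>a\<close>.
\<close>

lemma expected_upcrossings:
  assumes "0 \<le> a" "a < b"
  shows "integrable M (\<lambda>x. real (upcrossings (\<lambda>i. Z i x) a b n))"
    and "(\<integral>x. real (upcrossings (\<lambda>i. Z i x) a b n) \<partial>M) \<le> a / (b - a)"
proof -
  let ?U = "\<lambda>x. upcrossings (\<lambda>i. Z i x) a b n"
  let ?H = "\<lambda>i. {x \<in> space M. holding (\<lambda>i. Z i x) a b i}"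
  have "upcrossings (\<lambda>i. Z i x) a b n \<le> n" for x by (induction n) auto
  then show I: "integrable M (\<lambda>x. real (?U x))"
    by (intro integrable_const_bound[of _ "real n"]) auto
  have HF: "?H i \<in> sets (F i)" for i using holding_measurable[where a=a and b=b and n=i] by (simp add: pred_def)
  have HM: "?H i \<in> sets M" for i by measurable
  have J: "integrable M (\<lambda>x. indicator (?H i) x * Z j x)" for i j
    using HM integrable by (intro integrable_mult_indicator[where 'b=real, simplified real_scaleR_def]) auto
  have "(\<integral>x. (b - a) * real (?U x) - a \<partial>M)
        \<le> (\<integral>x. (\<Sum>i<n. indicator (?H i) x * Z (Suc i) x - indicator (?H i) x * Z i x) \<partial>M)"
  proof (rule integral_mono)
    show "integrable M (\<lambda>x. (b - a) * real (?U x) - a)" using I by auto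
    show "integrable M (\<lambda>x. \<Sum>i<n. indicator (?H i) x * Z (Suc i) x - indicator (?H i) x * Z i x)"
      using J by auto
    fix x assume x: "x \<in> space M"
    have "(b - a) * real (?U x) - a \<le>
      (b - a) * real (?U x) + (if holding (\<lambda>i. Z i x) a b n then Z n x - a else 0)"
      using nonneg[OF x, of n] assms by auto
    also have "\<dots> \<le> (\<Sum>i<n. if holding (\<lambda>i. Z i x) a b i then Z (Suc i) x - Z i x else 0)"
      using upcrossing_gain[of a b "\<lambda>i. Z i x" n] assms by simp
    also have "\<dots> = (\<Sum>i<n. indicator (?H i) x * Z (Suc i) x - indicator (?H i) x * Z i x)"
      using x by (intro sum.cong) auto
    finally show "(b - a) * real (?U x) - a \<le> (\<Sum>i<n. indicator (?H i) x * Z (Suc i) x - indicator (?H i) x * Z i x)" .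
  qed
  also have "\<dots> = (\<Sum>i<n. (\<integral>x. indicator (?H i) x * Z (Suc i) x \<partial>M) - (\<integral>x. indicator (?H i) x * Z i x \<partial>M))"
    using J by (subst Bochner_Integration.integral_sum) auto
  also have "\<dots> \<le> 0" using decreasing[OF HF] by (intro sum_nonpos) simp
  finally have "(b - a) * (\<integral>x. real (?U x) \<partial>M) \<le> a" using I by (simp add: prob_space)
  then show "(\<integral>x. real (?U x) \<partial>M) \<le> a / (b - a)" using assms by (simp add: field_simps)
qed

text \<open>
  A path that is infinitely often below \<open>a\<close> and infinitely often above \<open>b\<close> has infinitely many
  upcrossings, while their expected total number is finite by monotone convergence.
\<close>

lemma AE_no_oscillation:
  assumes "0 \<le> a" "a < b"
  shows "AE x in M. \<not> ((\<exists>\<^sub>F n in sequentially. Z n x < a) \<and> (\<exists>\<^sub>F n in sequentially. b \<le> Z n x))"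
proof -
  let ?U = "\<lambda>n x. upcrossings (\<lambda>i. Z i x) a b n"
  have "(\<integral>\<^sup>+x. (SUP n. ennreal (real (?U n x))) \<partial>M) = (SUP n. \<integral>\<^sup>+x. ennreal (real (?U n x)) \<partial>M)"
    by (intro nn_integral_monotone_convergence_SUP)
       (auto simp: incseq_def le_fun_def intro!: ennreal_leI upcrossings_mono)
  also have "\<dots> \<le> ennreal (a / (b - a))"
  proof (rule SUP_least)
    fix n
    have "(\<integral>\<^sup>+x. ennreal (real (?U n x)) \<partial>M) = ennreal (\<integral>x. real (?U n x) \<partial>M)"
      using expected_upcrossings(1)[OF assms] by (intro nn_integral_eq_integral) auto
    also have "\<dots> \<le> ennreal (a / (b - a))" using expected_upcrossings(2)[OF assms] by (intro ennreal_leI) simp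
    finally show "(\<integral>\<^sup>+x. ennreal (real (?U n x)) \<partial>M) \<le> ennreal (a / (b - a))" .
  qed
  finally have "(\<integral>\<^sup>+x. (SUP n. ennreal (real (?U n x))) \<partial>M) \<noteq> \<infinity>"
    by (auto simp: top_unique)
  then have "AE x in M. (SUP n. ennreal (real (?U n x))) \<noteq> \<infinity>"
    by (intro nn_integral_noteq_infinite) auto
  then show ?thesis
  proof eventually_elim
    case (elim x)
    then obtain r where r: "(SUP n. ennreal (real (?U n x))) = ennreal r" "r \<ge> 0"
      by (metis ennreal_cases infinity_ennreal_def)
    have "real (?U n x) \<le> r" for n
    proof -
      have "ennreal (real (?U n x)) \<le> ennreal r"
        unfolding r(1)[symmetric] by (intro SUP_upper) auto
      then show ?thesis using r by simp
    qed
    then have "?U n x \<le> nat \<lfloor>r\<rfloor>" for n by (simp add: le_nat_floor)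
    then have "\<not> (\<exists>n. Suc (nat \<lfloor>r\<rfloor>) \<le> ?U n x)" by (auto simp: not_less_eq_eq[symmetric])
    then show ?case using upcrossings_unbounded[of a b "\<lambda>i. Z i x"] assms by (meson less_imp_le)
  qed
qed

lemma expectation_antimono: "(\<integral>x. Z n x \<partial>M) \<le> (\<integral>x. Z 0 x \<partial>M)"
proof (induction n)
  case (Suc n)
  have "space M \<in> sets (F n)" using sets.top[of "F n"] by simp
  from decreasing[OF this] have "(\<integral>x. Z (Suc n) x \<partial>M) \<le> (\<integral>x. Z n x \<partial>M)"
    by (simp cong: Bochner_Integration.integral_cong)
  with Suc show ?case by simp
qed simp

text \<open>
  A sequence with different lower and upper limits oscillates across some rational interval,
  which almost surely never happens. Fatou's lemma excludes divergence to infinity.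
\<close>

theorem AE_convergent: "AE x in M. convergent (\<lambda>n. Z n x)"
proof -
  have "(\<integral>\<^sup>+x. liminf (\<lambda>n. ennreal (Z n x)) \<partial>M) \<le> liminf (\<lambda>n. \<integral>\<^sup>+x. ennreal (Z n x) \<partial>M)"
    by (intro nn_integral_liminf) auto
  also have "\<dots> \<le> limsup (\<lambda>n. \<integral>\<^sup>+x. ennreal (Z n x) \<partial>M)" by (intro Liminf_le_Limsup) auto
  also have "\<dots> \<le> ennreal (\<integral>x. Z 0 x \<partial>M)"
  proof (intro Limsup_bounded always_eventually allI)
    fix n
    have "(\<integral>\<^sup>+x. ennreal (Z n x) \<partial>M) = ennreal (\<integral>x. Z n x \<partial>M)"
      using nonneg integrable by (intro nn_integral_eq_integral) auto
    then show "(\<integral>\<^sup>+x. ennreal (Z n x) \<partial>M) \<le> ennreal (\<integral>x. Z 0 x \<partial>M)"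
      using expectation_antimono by (simp add: ennreal_leI)
  qed
  finally have "(\<integral>\<^sup>+x. liminf (\<lambda>n. ennreal (Z n x)) \<partial>M) \<noteq> \<infinity>" by (auto simp: top_unique)
  then have fin: "AE x in M. liminf (\<lambda>n. ennreal (Z n x)) \<noteq> \<infinity>"
    by (intro nn_integral_noteq_infinite) auto
  have osc: "AE x in M. \<forall>a\<in>\<rat>. \<forall>b\<in>\<rat>. 0 \<le> a \<and> a < b \<longrightarrow>
      \<not> ((\<exists>\<^sub>F n in sequentially. Z n x < a) \<and> (\<exists>\<^sub>F n in sequentially. b \<le> Z n x))"
    using AE_no_oscillation
    by (simp add: AE_ball_countable countable_rat del: not_frequently)
  show ?thesis using fin osc AE_space
  proof eventually_elim
    case (elim x)
    let ?z = "\<lambda>n. ereal (Z n x)"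
    have nn: "0 \<le> Z n x" for n using nonneg elim by auto
    have "\<not> liminf ?z < limsup ?z"
    proof
      assume lt: "liminf ?z < limsup ?z"
      have "0 \<le> liminf ?z" using nn by (intro Liminf_bounded always_eventually) auto
      obtain c where c: "liminf ?z < c" "c < limsup ?z" using dense[OF lt] by auto
      obtain a where a: "liminf ?z < ereal (real_of_rat a)" "ereal (real_of_rat a) < c"
        using ereal_dense3[OF c(1)] by auto
      obtain b where b: "c < ereal (real_of_rat b)" "ereal (real_of_rat b) < limsup ?z"
        using ereal_dense3[OF c(2)] by auto
      have "0 < ereal (real_of_rat a)" using \<open>0 \<le> liminf ?z\<close> a(1) by (rule le_less_trans)
      then have "0 \<le> real_of_rat a" by simp
      have "ereal (real_of_rat a) < ereal (real_of_rat b)" using a b by (meson less_trans)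
      then have ab: "real_of_rat a < real_of_rat b" by simp
      have 1: "\<exists>\<^sub>F n in sequentially. Z n x < real_of_rat a"
      proof (rule ccontr)
        assume "\<not> ?thesis"
        then have "\<forall>\<^sub>F n in sequentially. ereal (real_of_rat a) \<le> ?z n"
          by (simp add: not_frequently not_less)
        then have "ereal (real_of_rat a) \<le> liminf ?z" by (rule Liminf_bounded)
        with a show False by simp
      qed
      have 2: "\<exists>\<^sub>F n in sequentially. real_of_rat b \<le> Z n x"
      proof (rule ccontr)
        assume "\<not> ?thesis"
        then have "\<forall>\<^sub>F n in sequentially. ?z n \<le> ereal (real_of_rat b)"
          by (simp add: not_frequently not_le) (auto elim: eventually_mono)
        then have "limsup ?z \<le> ereal (real_of_rat b)" by (rule Limsup_bounded)
        with b show False by simp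
      qed
      have "real_of_rat a \<in> \<rat>" "real_of_rat b \<in> \<rat>" by auto
      with elim(2) 1 2 ab \<open>0 \<le> real_of_rat a\<close> show False by blast
    qed
    then have eq: "liminf ?z = limsup ?z"
      using Liminf_le_Limsup[of sequentially ?z] by (auto simp: not_less intro: antisym)
    have nonneg_lim: "0 \<le> liminf ?z" using nn by (intro Liminf_bounded always_eventually) auto
    have "liminf ?z \<noteq> \<infinity>"
    proof
      assume "liminf ?z = \<infinity>"
      then have "?z \<longlonglongrightarrow> \<infinity>" using eq by (intro Liminf_eq_Limsup) auto
      then have "filterlim (\<lambda>n. Z n x) at_top sequentially" by (simp add: tendsto_PInfty_eq_at_top)
      then have "(\<lambda>n. ennreal (Z n x)) \<longlonglongrightarrow> \<infinity>"
        by (simp add: ennreal_tendsto_top_eq_at_top)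
      then have "liminf (\<lambda>n. ennreal (Z n x)) = \<infinity>" by (intro lim_imp_Liminf) auto
      with elim show False by simp
    qed
    then obtain r where r: "liminf ?z = ereal r" using nonneg_lim by (cases "liminf ?z") auto
    have "?z \<longlonglongrightarrow> ereal r" using eq r by (intro Liminf_eq_Limsup) auto
    then show ?case by (auto simp: convergent_def)
  qed
qed

end

section \<open>Growth of slowly varying functions\<close>

text \<open>
  For \<open>l t = ln (L (exp t))\<close> slow variation of \<open>L\<close> is the pointwise convergence of increments
  assumed here. Local uniformity is obtained by averaging: if the increment over \<open>u n\<close> from
  \<open>t n\<close> were larger than 2, then for every \<open>v\<close> one of the increments from
  \<open>t n\<close> and from \<open>t n + u n\<close> to the point \<open>t n + v\<close> would exceed 1. The averages of both over \<open>v\<close>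
  tend to zero by dominated convergence.
\<close>

lemma additively_slowly_varying_locally_bounded:
  fixes l :: "real \<Rightarrow> real"
  assumes [measurable]: "l \<in> borel_measurable borel"
    and lim: "\<And>u. ((\<lambda>t. l (t + u) - l t) \<longlongrightarrow> 0) at_top"
  shows "\<exists>T. \<forall>t\<ge>T. \<forall>u\<in>{0..1}. \<bar>l (t + u) - l t\<bar> \<le> 2"
proof (rule ccontr)
  assume "\<not> ?thesis"
  then have "\<forall>n::nat. \<exists>t u. t \<ge> real n \<and> u \<in> {0..1} \<and> \<bar>l (t + u) - l t\<bar> > 2"
    by (metis not_le)
  then obtain t u where t: "\<And>n. t n \<ge> real n" and u: "\<And>n. u n \<in> {0..1}"
    and big: "\<And>n. \<bar>l (t n + u n) - l (t n)\<bar> > 2" by metis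
  define D where "D s v = indicator {0..3} v * min 1 \<bar>l (s + v) - l s\<bar>" for s v :: real
  have [measurable]: "D s \<in> borel_measurable borel" for s unfolding D_def by measurable
  have D_bound: "norm (D s v) \<le> indicator {0..3} v" for s v by (auto simp: D_def indicator_def)
  have I3: "integrable lborel (indicator {0..3::real} :: real \<Rightarrow> real)" by simp
  have D_int: "integrable lborel (D s)" for s
    by (rule Bochner_Integration.integrable_bound[OF I3]) (use D_bound in auto)
  have D_lim: "(\<lambda>n. \<integral>v. D (s n) v \<partial>lborel) \<longlonglongrightarrow> 0" if s: "filterlim s at_top sequentially" for s
  proof -
    have "(\<lambda>n. \<integral>v. D (s n) v \<partial>lborel) \<longlonglongrightarrow> (\<integral>v. 0 \<partial>(lborel::real measure))"
    proof (rule integral_dominated_convergence[where w="indicator {0..3}" and f="\<lambda>_. 0" and s="\<lambda>n. D (s n)"])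
      show "AE v in lborel. (\<lambda>n. D (s n) v) \<longlonglongrightarrow> 0"
      proof (rule AE_I2)
        fix v
        have "(\<lambda>n. l (s n + v) - l (s n)) \<longlonglongrightarrow> 0"
          using filterlim_compose[OF lim s, of v] .
        then have "(\<lambda>n. indicator {0..3} v * min 1 \<bar>l (s n + v) - l (s n)\<bar>) \<longlonglongrightarrow> indicator {0..3} v * min 1 \<bar>0\<bar>"
          by (intro tendsto_intros)
        then show "(\<lambda>n. D (s n) v) \<longlonglongrightarrow> 0" by (simp add: D_def)
      qed
    qed (use D_bound I3 in auto)
    then show ?thesis by simp
  qed
  have t_lim: "filterlim t at_top sequentially"
    by (rule filterlim_at_top_mono[OF filterlim_real_sequentially]) (use t in auto)
  have tu_lim: "filterlim (\<lambda>n. t n + u n) at_top sequentially"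
    by (rule filterlim_at_top_mono[OF t_lim]) (use u in auto)
  have "2 \<le> (\<integral>v. D (t n) v \<partial>lborel) + (\<integral>v. D (t n + u n) v \<partial>lborel)" for n
  proof -
    \<comment> \<open>Both increments end at the same point after a translation by \<open>u n\<close>, which lies in $[0,1]$;\<close>
    \<comment> \<open>hence every \<open>v\<close> in $[1,3]$ is covered by the window $[0,3]$ of either integral.\<close>
    have shift: "(\<integral>v. D (t n + u n) v \<partial>lborel) = (\<integral>v. D (t n + u n) (- u n + v) \<partial>lborel)"
      using lborel_integral_real_affine[of 1 "D (t n + u n)" "- u n"] by simp
    have shift_int: "integrable lborel (\<lambda>v. D (t n + u n) (- u n + v))"
      using lborel_integrable_real_affine[OF D_int, of 1 "t n + u n" "- u n"] by simp
    have "(\<integral>v. indicator {1..3::real} v \<partial>lborel) \<le> (\<integral>v. D (t n) v + D (t n + u n) (- u n + v) \<partial>lborel)"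
    proof (rule integral_mono)
      show "indicator {1..3} v \<le> D (t n) v + D (t n + u n) (- u n + v)" for v
        using u[of n] big[of n] by (auto simp: D_def indicator_def)
    qed (use D_int shift_int in auto)
    then show ?thesis using D_int shift_int shift by simp
  qed
  moreover have "(\<lambda>n. (\<integral>v. D (t n) v \<partial>lborel) + (\<integral>v. D (t n + u n) v \<partial>lborel)) \<longlonglongrightarrow> 0 + 0"
    by (intro tendsto_add D_lim t_lim tu_lim)
  ultimately have "2 \<le> (0::real) + 0" by (intro LIMSEQ_le_const) auto
  then show False by simp
qed

text \<open>
  Steps of length one eventually raise \<open>l\<close> by less than \<open>\<epsilon>\<close>, and the fractional rest of the
  distance costs only a constant by local boundedness.
\<close>

lemma additively_slowly_varying_linear_growth:
  fixes l :: "real \<Rightarrow> real"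
  assumes [measurable]: "l \<in> borel_measurable borel"
    and lim: "\<And>u. ((\<lambda>t. l (t + u) - l t) \<longlongrightarrow> 0) at_top"
    and "\<epsilon> > 0"
  shows "\<exists>T C. \<forall>t\<ge>T. l t \<le> C + \<epsilon> * t"
proof -
  obtain T where T: "\<And>t u. t \<ge> T \<Longrightarrow> u \<in> {0..1} \<Longrightarrow> \<bar>l (t + u) - l t\<bar> \<le> 2"
    using additively_slowly_varying_locally_bounded[OF assms(1,2)] by blast
  have "\<forall>\<^sub>F t in at_top. l (t + 1) - l t < \<epsilon>"
    using lim[of 1] \<open>\<epsilon> > 0\<close> by (rule order_tendstoD)
  then obtain T' where T': "\<And>t. t \<ge> T' \<Longrightarrow> l (t + 1) - l t < \<epsilon>"
    by (auto simp: eventually_at_top_linorder)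
  define S where "S = max T T'"
  have step: "l (S + real k) \<le> l S + \<epsilon> * real k" for k
  proof (induction k)
    case (Suc k)
    have "l (S + real k + 1) - l (S + real k) < \<epsilon>" by (rule T') (simp add: S_def)
    then show ?case using Suc by (simp add: algebra_simps)
  qed simp
  have "l t \<le> (l S + 2 - \<epsilon> * S) + \<epsilon> * t" if "t \<ge> S" for t
  proof -
    define k where "k = nat \<lfloor>t - S\<rfloor>"
    have k: "real k = of_int \<lfloor>t - S\<rfloor>" using that by (simp add: k_def)
    have "\<bar>l (S + real k + (t - S - real k)) - l (S + real k)\<bar> \<le> 2"
    proof (rule T)
      show "T \<le> S + real k" by (simp add: S_def)
      show "t - S - real k \<in> {0..1}" unfolding k by (simp, linarith)
    qed
    then have "l t \<le> l (S + real k) + 2" by simp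
    also have "\<dots> \<le> l S + \<epsilon> * real k + 2" using step by simp
    also have "\<epsilon> * real k \<le> \<epsilon> * (t - S)" using \<open>\<epsilon> > 0\<close> unfolding k by (intro mult_left_mono) linarith+
    finally show ?thesis by (simp add: algebra_simps)
  qed
  then show ?thesis by blast
qed

text \<open>
  The linear bound for \<open>ln \<circ> L \<circ> exp\<close> covers large arguments; the finitely many remaining integers
  are absorbed into the constant.
\<close>

lemma slowly_varying_le_powr:
  assumes L: "slowly_varying L" and "\<epsilon> > 0"
  shows "\<exists>C. \<forall>n\<ge>1. L (real n) \<le> C * real n powr \<epsilon>"
proof -
  have meas: "L \<in> borel_measurable (restrict_space borel {0<..})" and pos: "\<And>x. x > 0 \<Longrightarrow> L x > 0"
    and lim: "\<And>u. u > 0 \<Longrightarrow> ((\<lambda>x. L (x * u) / L x) \<longlongrightarrow> 1) at_top"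
    using L by (auto simp: slowly_varying_def)
  define l where "l t = ln (L (exp t))" for t
  have "exp \<in> measurable borel (restrict_space borel {0::real<..})"
    by (intro measurable_restrict_space2) auto
  from measurable_compose[OF this meas] have [measurable]: "l \<in> borel_measurable borel"
    unfolding l_def by measurable
  have "((\<lambda>t. l (t + u) - l t) \<longlongrightarrow> 0) at_top" for u
  proof -
    have "((\<lambda>t. L (exp t * exp u) / L (exp t)) \<longlongrightarrow> 1) at_top"
      by (rule filterlim_compose[OF lim exp_at_top]) simp
    then have "((\<lambda>t. ln (L (exp t * exp u) / L (exp t))) \<longlongrightarrow> ln 1) at_top"
      by (intro tendsto_ln) auto
    then show ?thesis by (simp add: l_def ln_div pos less_imp_neq[symmetric] exp_add)
  qed
  then obtain T C where T: "\<And>t. t \<ge> T \<Longrightarrow> l t \<le> C + \<epsilon> * t"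
    using additively_slowly_varying_linear_growth[of l \<epsilon>] \<open>\<epsilon> > 0\<close> by (auto simp: l_def)
  define m where "m = nat \<lceil>exp T\<rceil>"
  define K where "K = (\<Sum>n=1..m. L (real n)) + exp C"
  have sum_nn: "0 \<le> (\<Sum>n=1..m. L (real n))" using pos by (intro sum_nonneg less_imp_le) auto
  have "L (real n) \<le> K * real n powr \<epsilon>" if n: "n \<ge> 1" for n
  proof (cases "n \<le> m")
    case True
    have "L (real n) \<le> (\<Sum>n=1..m. L (real n))" using n True pos by (intro member_le_sum less_imp_le) auto
    also have "\<dots> \<le> K * 1" by (simp add: K_def)
    also have "\<dots> \<le> K * real n powr \<epsilon>"
      using sum_nn n \<open>\<epsilon> > 0\<close> by (intro mult_left_mono ge_one_powr_ge_zero) (auto simp: K_def)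
    finally show ?thesis .
  next
    case False
    then have "exp T \<le> real n" by (simp add: m_def) linarith
    then have "T \<le> ln (real n)" using n by (simp add: ln_ge_iff)
    from T[OF this] have "L (real n) \<le> exp (C + \<epsilon> * ln (real n))"
      using n pos[of "real n"] by (metis exp_le_cancel_iff exp_ln l_def of_nat_0_less_iff less_le_trans zero_less_one)
    also have "\<dots> = exp C * real n powr \<epsilon>" using n by (simp add: powr_def exp_add)
    also have "\<dots> \<le> K * real n powr \<epsilon>" using sum_nn by (intro mult_right_mono) (auto simp: K_def)
    finally show ?thesis .
  qed
  then show ?thesis by blast
qed

section \<open>Contacts of a heavy-tailed renewal\<close>

text \<open>
  The fractions of \<open>x + y\<close> made up by \<open>x\<close> and \<open>y\<close> are at most one, so raising them to the power
  \<open>a \<le> 1\<close> does not decrease them.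
\<close>

lemma powr_add_le:
  fixes x y a :: real
  assumes "0 \<le> x" "0 \<le> y" "0 < a" "a \<le> 1"
  shows "(x + y) powr a \<le> x powr a + y powr a"
proof (cases "x + y = 0")
  case True
  then show ?thesis using assms by simp
next
  case False
  let ?s = "x + y"
  have s: "?s > 0" using False assms by simp
  have frac: "z / ?s \<le> z powr a / ?s powr a" if "0 \<le> z" "z \<le> ?s" for z
  proof -
    have "(z / ?s) powr 1 \<le> (z / ?s) powr a" using that s assms by (intro powr_mono') auto
    then show ?thesis using that s by (simp add: powr_divide)
  qed
  have "1 = x / ?s + y / ?s" using s by (simp add: add_divide_distrib[symmetric])
  also have "\<dots> \<le> x powr a / ?s powr a + y powr a / ?s powr a"
    using assms by (intro add_mono frac) auto
  finally show ?thesis using s by (simp add: field_simps)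
qed

definition contacts :: "(nat \<Rightarrow> 'a \<Rightarrow> nat) \<Rightarrow> nat \<Rightarrow> 'a \<Rightarrow> nat set" where
  "contacts \<tau> N y = renewal_set \<tau> y \<inter> {1..N}"

lemma finite_contacts [simp]: "finite (contacts \<tau> N y)"
  by (simp add: contacts_def)

context renewal_process
begin

lemma contacts_measurable [measurable]:
  "contacts \<tau> N \<in> measurable M (count_space (Pow {1..N}))"
proof -
  have hit: "{y \<in> space M. n \<in> renewal_set \<tau> y} \<in> sets M" for n
  proof -
    have "\<tau> k -` {n} \<inter> space M \<in> sets M" for k
      by (rule measurable_sets[OF tau_measurable]) simp
    then have "(\<Union>k. \<tau> k -` {n} \<inter> space M) \<in> sets M" by blast
    also have "(\<Union>k. \<tau> k -` {n} \<inter> space M) = {y \<in> space M. n \<in> renewal_set \<tau> y}"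
      unfolding renewal_set_def by blast
    finally show ?thesis .
  qed
  have "contacts \<tau> N -` {A} \<inter> space M \<in> sets M" if A: "A \<subseteq> {1..N}" for A
  proof -
    have "contacts \<tau> N -` {A} \<inter> space M
        = {y \<in> space M. \<forall>n\<in>{1..N}. (n \<in> renewal_set \<tau> y) = (n \<in> A)}"
      using A unfolding contacts_def by blast
    also have "\<dots> \<in> sets M"
    proof (intro sets.sets_Collect_finite_All)
      show "{y \<in> space M. (n \<in> renewal_set \<tau> y) = (n \<in> A)} \<in> sets M" for n
        using hit[of n] sets.sets_Collect_neg[OF hit[of n]] by (cases "n \<in> A") auto
    qed simp
    finally show ?thesis .
  qed
  then show ?thesis
    by (subst measurable_count_space_eq2) (auto simp: contacts_def)
qed

lemma card_contacts_measurable [measurable]: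
  "(\<lambda>y. card (contacts \<tau> N y)) \<in> measurable M (count_space UNIV)"
  by (rule measurable_compose[OF contacts_measurable]) simp

text \<open>
  The law of the first gap turns the moment into the series of \<open>L n * n powr (a - 1 - \<alpha>)\<close>,
  which converges because \<open>L\<close> is dominated by every positive power.
\<close>

lemma gap_moment:
  assumes "a < \<alpha>"
  shows "integrable M (\<lambda>y. real (\<tau> 1 y) powr a)"
proof -
  note tau_measurable[measurable]
  \<comment> \<open>Half of the available exponent is spent on \<open>L\<close>; the other half makes the series converge.\<close>
  define \<epsilon> where "\<epsilon> = (\<alpha> - a) / 2"
  have \<epsilon>: "\<epsilon> > 0" using assms by (simp add: \<epsilon>_def)
  obtain C where C: "\<And>n. n \<ge> 1 \<Longrightarrow> L (real n) \<le> C * real n powr \<epsilon>"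
    using slowly_varying_le_powr[OF slowly_varying_L \<epsilon>] by auto
  let ?E = "\<lambda>n. {y \<in> space M. \<tau> 1 y = n}"
  have term_le: "real n powr a * prob (?E n) \<le> C * real n powr (- 1 - \<epsilon>)" for n
  proof (cases "n = 0")
    case False
    then have "real n powr a * prob (?E n) = L (real n) * real n powr (a - (1 + \<alpha>))"
      by (simp add: tau_1_law[unfolded One_nat_def] powr_diff)
    also have "\<dots> \<le> (C * real n powr \<epsilon>) * real n powr (a - (1 + \<alpha>))"
      using C[of n] False by (intro mult_right_mono) auto
    also have "\<dots> = C * real n powr (- 1 - \<epsilon>)"
      by (simp add: powr_add[symmetric] \<epsilon>_def field_simps)
    finally show ?thesis .
  qed simp
  have "summable (\<lambda>n. C * real n powr (- 1 - \<epsilon>))"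
    using \<epsilon> by (intro summable_mult) (simp add: summable_real_powr_iff)
  then have sum: "summable (\<lambda>n. real n powr a * prob (?E n))"
    by (rule summable_comparison_test'[where N=0]) (use term_le in auto)
  have "(\<integral>\<^sup>+y. ennreal (real (\<tau> 1 y) powr a) \<partial>M)
      = (\<integral>\<^sup>+y. (\<Sum>n. ennreal (real n powr a) * indicator (?E n) y) \<partial>M)"
  proof (rule nn_integral_cong)
    fix y assume y: "y \<in> space M"
    have "(\<Sum>n. ennreal (real n powr a) * indicator (?E n) y)
        = (\<Sum>n\<in>{\<tau> 1 y}. ennreal (real n powr a) * indicator (?E n) y)"
      by (intro suminf_finite) auto
    then show "ennreal (real (\<tau> 1 y) powr a) = (\<Sum>n. ennreal (real n powr a) * indicator (?E n) y)"
      using y by simp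
  qed
  also have "\<dots> = (\<Sum>n. ennreal (real n powr a) * emeasure M (?E n))"
    by (subst nn_integral_suminf) (auto simp: nn_integral_cmult_indicator)
  also have "\<dots> = (\<Sum>n. ennreal (real n powr a * prob (?E n)))"
    by (simp add: emeasure_eq_measure ennreal_mult)
  also have "\<dots> < \<infinity>"
    unfolding infinity_ennreal_def less_top[symmetric]
    by (intro ennreal_suminf_neq_top sum) auto
  finally show ?thesis by (intro integrableI_nonneg) auto
qed

text \<open>
  The renewal time is a sum of identically distributed gaps, and the power \<open>a \<le> 1\<close> is
  subadditive.
\<close>

lemma renewal_moment:
  assumes a: "0 < a" "a \<le> 1" "a < \<alpha>"
  shows "integrable M (\<lambda>y. real (\<tau> k y) powr a)"
    and "(\<integral>y. real (\<tau> k y) powr a \<partial>M) \<le> real k * (\<integral>y. real (\<tau> 1 y) powr a \<partial>M)"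
proof -
  note tau_measurable[measurable]
  define g where "g i y = real (\<tau> (Suc i) y - \<tau> i y) powr a" for i y
  have first: "g 0 y = real (\<tau> 1 y) powr a" if "y \<in> space M" for y
    using tau_0[OF that] by (simp add: g_def)
  have [measurable]: "g i \<in> borel_measurable M" for i unfolding g_def by measurable
  have int0: "integrable M (g 0)"
    using gap_moment[OF a(3)] first by (simp cong: Bochner_Integration.integrable_cong)
  have distr: "distr M borel (g i) = distr M borel (g 0)" for i
  proof -
    have "distr M borel (g j) =
        distr (distr M (count_space UNIV) (\<lambda>y. \<tau> (Suc j) y - \<tau> j y)) borel (\<lambda>n. real n powr a)" for j
      by (subst distr_distr) (auto simp: comp_def g_def[abs_def])
    then show ?thesis using increments_identically_distributed[of i] by simp
  qed
  have int: "integrable M (g i)" for i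
  proof -
    have "integrable M (g j) \<longleftrightarrow> integrable (distr M borel (g j)) (\<lambda>v. v)" for j
      by (subst integrable_distr_eq) auto
    then show ?thesis using int0 distr[of i] by simp
  qed
  have eq: "(\<integral>y. g i y \<partial>M) = (\<integral>y. real (\<tau> 1 y) powr a \<partial>M)" for i
  proof -
    have "(\<integral>y. g i y \<partial>M) = (\<integral>v. v \<partial>distr M borel (g i))" by (subst integral_distr) auto
    also have "\<dots> = (\<integral>y. g 0 y \<partial>M)" by (subst distr, subst integral_distr) auto
    also have "\<dots> = (\<integral>y. real (\<tau> 1 y) powr a \<partial>M)"
      by (intro Bochner_Integration.integral_cong refl first)
    finally show ?thesis .
  qed
  have le: "real (\<tau> k y) powr a \<le> (\<Sum>i<k. g i y)" if y: "y \<in> space M" for y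
  proof (induction k)
    case 0
    then show ?case using tau_0[OF y] by simp
  next
    case (Suc k)
    have "real (\<tau> (Suc k) y) = real (\<tau> k y) + real (\<tau> (Suc k) y - \<tau> k y)"
      using tau_less[OF y, of k] by linarith
    then have "real (\<tau> (Suc k) y) powr a \<le> real (\<tau> k y) powr a + g k y"
      using a powr_add_le[of "real (\<tau> k y)" "real (\<tau> (Suc k) y - \<tau> k y)" a] by (simp only: g_def)
    then show ?case using Suc.IH by (simp only: sum.lessThan_Suc)
  qed
  show I: "integrable M (\<lambda>y. real (\<tau> k y) powr a)"
  proof (rule Bochner_Integration.integrable_bound)
    show "integrable M (\<lambda>y. \<Sum>i<k. g i y)" by (intro Bochner_Integration.integrable_sum int)
    show "(\<lambda>y. real (\<tau> k y) powr a) \<in> borel_measurable M" by measurable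
    show "AE y in M. norm (real (\<tau> k y) powr a) \<le> norm (\<Sum>i<k. g i y)"
    proof (rule AE_I2)
      fix y assume "y \<in> space M"
      then have "real (\<tau> k y) powr a \<le> (\<Sum>i<k. g i y)" by (rule le)
      then show "norm (real (\<tau> k y) powr a) \<le> norm (\<Sum>i<k. g i y)"
        using powr_ge_zero[of "real (\<tau> k y)" a] unfolding real_norm_def by linarith
    qed
  qed
  have "(\<integral>y. real (\<tau> k y) powr a \<partial>M) \<le> (\<integral>y. (\<Sum>i<k. g i y) \<partial>M)"
    by (intro integral_mono I le Bochner_Integration.integrable_sum int)
  also have "\<dots> = real k * (\<integral>y. real (\<tau> 1 y) powr a \<partial>M)"
    by (subst Bochner_Integration.integral_sum[OF int]) (simp add: eq)
  finally show "(\<integral>y. real (\<tau> k y) powr a \<partial>M) \<le> real k * (\<integral>y. real (\<tau> 1 y) powr a \<partial>M)" .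
qed

lemma le_card_contacts:
  assumes y: "y \<in> space M" and "\<tau> k y \<le> N"
  shows "k \<le> card (contacts \<tau> N y)"
proof -
  have mono: "strict_mono (\<lambda>k. \<tau> k y)" using tau_less[OF y] by (simp add: strict_mono_Suc_iff)
  have "(\<lambda>k. \<tau> k y) ` {1..k} \<subseteq> contacts \<tau> N y"
  proof
    fix n assume "n \<in> (\<lambda>k. \<tau> k y) ` {1..k}"
    then obtain i where i: "n = \<tau> i y" "1 \<le> i" "i \<le> k" by auto
    have "\<tau> 0 y < \<tau> i y" using mono i by (auto simp: strict_mono_def)
    moreover have "\<tau> i y \<le> \<tau> k y" using mono i by (auto dest: strict_mono_leD)
    ultimately show "n \<in> contacts \<tau> N y" using i assms by (auto simp: contacts_def renewal_set_def)
  qed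
  then have "card ((\<lambda>k. \<tau> k y) ` {1..k}) \<le> card (contacts \<tau> N y)"
    by (rule card_mono[rotated]) simp
  moreover have "inj_on (\<lambda>k. \<tau> k y) {1..k}"
    using mono by (meson inj_on_subset strict_mono_imp_inj_on subset_UNIV)
  ultimately show ?thesis by (simp add: card_image)
qed

text \<open>
  Few contacts force the renewal time with index about \<open>N powr \<gamma>\<close> beyond \<open>N\<close>, and Markov's inequality
  for a moment of order \<open>a\<close> strictly between \<open>\<gamma>\<close> and \<open>min \<alpha> 1\<close> makes this unlikely.
\<close>

lemma few_contacts_unlikely:
  assumes \<gamma>: "\<gamma> < \<alpha>" "\<gamma> < 1"
  shows "(\<lambda>N. prob {y \<in> space M. real (card (contacts \<tau> N y)) \<le> real N powr \<gamma>}) \<longlonglongrightarrow> 0"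
proof -
  note tau_measurable[measurable]
  \<comment> \<open>Negative exponents are replaced by zero, so that the index \<open>k\<close> is at most $2 N^g$ below.\<close>
  define g where "g = max \<gamma> 0"
  obtain a where a: "g < a" "a < min \<alpha> 1"
    using dense[of g "min \<alpha> 1"] \<gamma> alpha_pos by (auto simp: g_def)
  have a0: "0 < a" "a \<le> 1" "a < \<alpha>" using a by (auto simp: g_def)
  define m where "m = (\<integral>y. real (\<tau> 1 y) powr a \<partial>M)"
  have m: "m \<ge> 0" unfolding m_def by (intro Bochner_Integration.integral_nonneg) auto
  have bound: "prob {y \<in> space M. real (card (contacts \<tau> N y)) \<le> real N powr \<gamma>} \<le> 2 * m * real N powr (g - a)"
    if N: "N \<ge> 1" for N
  proof -
    define k where "k = Suc (nat \<lfloor>real N powr \<gamma>\<rfloor>)"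
    have "real N powr \<gamma> \<le> real N powr g" using N by (intro powr_mono) (auto simp: g_def)
    moreover have "1 \<le> real N powr g" using N by (intro ge_one_powr_ge_zero) (auto simp: g_def)
    moreover have "real k \<le> real N powr \<gamma> + 1" by (simp add: k_def)
    ultimately have k: "real k \<le> 2 * real N powr g" by linarith
    have "prob {y \<in> space M. real (card (contacts \<tau> N y)) \<le> real N powr \<gamma>}
        \<le> prob {y \<in> space M. real (\<tau> k y) powr a \<ge> real N powr a}"
    proof (intro finite_measure_mono subsetI)
      fix y assume "y \<in> {y \<in> space M. real (card (contacts \<tau> N y)) \<le> real N powr \<gamma>}"
      then have y: "y \<in> space M" and c: "real (card (contacts \<tau> N y)) \<le> real N powr \<gamma>" by auto
      from c have "card (contacts \<tau> N y) < k" by (simp add: k_def le_nat_floor le_imp_less_Suc)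
      then have "\<not> \<tau> k y \<le> N" using le_card_contacts[OF y, of k N] by auto
      then have "real N powr a \<le> real (\<tau> k y) powr a" using a0 by (intro powr_mono2) auto
      then show "y \<in> {y \<in> space M. real (\<tau> k y) powr a \<ge> real N powr a}" using y by simp
    qed simp
    also have "\<dots> \<le> (\<integral>y. real (\<tau> k y) powr a \<partial>M) / real N powr a"
      using N by (intro integral_Markov_inequality_measure[OF renewal_moment(1)[OF a0] sets.empty_sets]) auto
    also have "\<dots> \<le> (real k * m) / real N powr a"
      unfolding m_def by (intro divide_right_mono renewal_moment(2)[OF a0]) auto
    also have "\<dots> \<le> (2 * real N powr g * m) / real N powr a"
      using k m by (intro divide_right_mono mult_right_mono) auto
    also have "\<dots> = 2 * m * real N powr (g - a)" by (simp add: powr_diff)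
    finally show ?thesis .
  qed
  have "(\<lambda>N. real N powr (g - a)) \<longlonglongrightarrow> 0"
    using a by (intro tendsto_neg_powr filterlim_real_sequentially) auto
  then have "(\<lambda>N. 2 * m * real N powr (g - a)) \<longlonglongrightarrow> 2 * m * 0" by (intro tendsto_intros)
  then have lim: "(\<lambda>N. 2 * m * real N powr (g - a)) \<longlonglongrightarrow> 0" by simp
  show ?thesis
    by (rule tendsto_sandwich[OF _ _ tendsto_const lim])
       (use bound in \<open>auto simp: eventually_sequentially\<close>)
qed

end

section \<open>Integration over the environment and over contact sets\<close>

lemma (in prob_space) expectation_pos:
  fixes f :: "'a \<Rightarrow> real"
  assumes "integrable M f" "\<And>x. x \<in> space M \<Longrightarrow> 0 < f x"
  shows "0 < expectation f"
proof -
  have nn: "AE x in M. 0 \<le> f x" using assms by (intro AE_I2 less_imp_le)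
  have "expectation f \<noteq> 0"
  proof
    assume "expectation f = 0"
    then have "AE x in M. f x = 0" using integral_nonneg_eq_0_iff_AE[OF assms(1) nn] by simp
    then have "AE x in M. False" using AE_space by eventually_elim (use assms in force)
    then show False by simp
  qed
  moreover have "0 \<le> expectation f" using nn by (rule integral_nonneg_AE)
  ultimately show ?thesis by simp
qed

text \<open>
  All integrals over the renewal depend on it through its contact set in a finite interval
  only, so they are finite sums; this is what permits exchanging them with integrals over the
  environment.
\<close>

lemma integral_finite_range:
  fixes f :: "'c \<Rightarrow> real"
  assumes "finite_measure M" "finite S" and R: "R \<in> measurable M (count_space S)"
  shows integrable_finite_range: "integrable M (\<lambda>y. f (R y))"
    and "(\<integral>y. f (R y) \<partial>M) = (\<Sum>A\<in>S. measure M (R -` {A} \<inter> space M) * f A)"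
proof -
  interpret finite_measure M by fact
  have sets: "R -` {A} \<inter> space M \<in> sets M" if "A \<in> S" for A
    using measurable_sets[OF R, of "{A}"] that by simp
  have int: "integrable M (\<lambda>y. indicator (R -` {A} \<inter> space M) y * f A)" if "A \<in> S" for A
    using sets[OF that] by (intro integrable_mult_left) (simp add: emeasure_eq_measure)
  have eq: "f (R y) = (\<Sum>A\<in>S. indicator (R -` {A} \<inter> space M) y * f A)" if y: "y \<in> space M" for y
  proof -
    have "R y \<in> S" using measurable_space[OF R y] by simp
    have "(\<Sum>A\<in>S. indicator (R -` {A} \<inter> space M) y * f A) = (\<Sum>A\<in>S. if A = R y then f A else 0)"
      using y by (intro sum.cong) (auto simp: indicator_def)
    also have "\<dots> = f (R y)" using \<open>R y \<in> S\<close> \<open>finite S\<close> by (simp add: sum.delta)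
    finally show ?thesis by simp
  qed
  have "integrable M (\<lambda>y. \<Sum>A\<in>S. indicator (R -` {A} \<inter> space M) y * f A)"
    by (intro Bochner_Integration.integrable_sum int)
  then show "integrable M (\<lambda>y. f (R y))"
    by (subst Bochner_Integration.integrable_cong[OF refl eq])
  have "(\<integral>y. f (R y) \<partial>M) = (\<integral>y. (\<Sum>A\<in>S. indicator (R -` {A} \<inter> space M) y * f A) \<partial>M)"
    by (intro Bochner_Integration.integral_cong refl eq)
  also have "\<dots> = (\<Sum>A\<in>S. measure M (R -` {A} \<inter> space M) * f A)"
    by (subst Bochner_Integration.integral_sum[OF int]) (auto intro!: sum.cong simp: sets)
  finally show "(\<integral>y. f (R y) \<partial>M) = (\<Sum>A\<in>S. measure M (R -` {A} \<inter> space M) * f A)" .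
qed

context environment
begin

lemma omega_measurable: "1 \<le> n \<Longrightarrow> \<omega> n \<in> borel_measurable Q"
  using omega_indep by (auto simp: indep_vars_def)

lemma identically_distributed_integral:
  fixes f :: "real \<Rightarrow> real"
  assumes f: "f \<in> borel_measurable borel" and n: "1 \<le> n"
  shows "integrable Q (\<lambda>x. f (\<omega> n x)) \<longleftrightarrow> integrable Q (\<lambda>x. f (\<omega> 1 x))"
    and "(\<integral>x. f (\<omega> n x) \<partial>Q) = (\<integral>x. f (\<omega> 1 x) \<partial>Q)"
proof -
  have "integrable Q (\<lambda>x. f (\<omega> k x)) \<longleftrightarrow> integrable (distr Q borel (\<omega> k)) f" if "1 \<le> k" for k
    using integrable_distr_eq[OF omega_measurable[OF that] f] by simp
  from this[of n] this[of 1] n show "integrable Q (\<lambda>x. f (\<omega> n x)) \<longleftrightarrow> integrable Q (\<lambda>x. f (\<omega> 1 x))"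
    using omega_identically_distributed[OF n] by simp
  have "(\<integral>x. f (\<omega> k x) \<partial>Q) = (\<integral>v. f v \<partial>distr Q borel (\<omega> k))" if "1 \<le> k" for k
    using integral_distr[OF omega_measurable[OF that] f] by simp
  from this[of n] this[of 1] n show "(\<integral>x. f (\<omega> n x) \<partial>Q) = (\<integral>x. f (\<omega> 1 x) \<partial>Q)"
    using omega_identically_distributed[OF n] by simp
qed

text \<open>
  Independence factorises the expectation of a product over sites. The two site functions
  describe the contact sites and the remaining ones.
\<close>

lemma site_product:
  fixes \<phi> \<psi> :: "real \<Rightarrow> real"
  assumes [measurable]: "\<phi> \<in> borel_measurable borel" "\<psi> \<in> borel_measurable borel"
    and int: "integrable Q (\<lambda>x. \<phi> (\<omega> 1 x))" "integrable Q (\<lambda>x. \<psi> (\<omega> 1 x))"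
    and A: "A \<subseteq> {1..N}"
  shows integrable_site_product: "integrable Q (\<lambda>x. \<Prod>n=1..N. if n \<in> A then \<phi> (\<omega> n x) else \<psi> (\<omega> n x))"
    and "(\<integral>x. (\<Prod>n=1..N. if n \<in> A then \<phi> (\<omega> n x) else \<psi> (\<omega> n x)) \<partial>Q)
       = (\<integral>x. \<phi> (\<omega> 1 x) \<partial>Q) ^ card A * (\<integral>x. \<psi> (\<omega> 1 x) \<partial>Q) ^ (N - card A)"
proof -
  let ?f = "\<lambda>n v. if n \<in> A then \<phi> v else \<psi> v"
  have f: "?f n \<in> borel_measurable borel" for n by (cases "n \<in> A") auto
  have "indep_vars (\<lambda>_. borel) (\<lambda>n x. ?f n (\<omega> n x)) {1..N}"
    by (rule indep_vars_compose2[OF indep_vars_subset[OF omega_indep]]) (use f in auto)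
  moreover have "integrable Q (\<lambda>x. ?f n (\<omega> n x))" if "n \<in> {1..N}" for n
    using identically_distributed_integral(1)[of \<phi> n] identically_distributed_integral(1)[of \<psi> n] int that
    by (cases "n \<in> A") auto
  ultimately have *: "integrable Q (\<lambda>x. \<Prod>n=1..N. ?f n (\<omega> n x))"
    "(\<integral>x. (\<Prod>n=1..N. ?f n (\<omega> n x)) \<partial>Q) = (\<Prod>n=1..N. \<integral>x. ?f n (\<omega> n x) \<partial>Q)"
    using indep_vars_integrable[of "{1..N}" "\<lambda>n x. ?f n (\<omega> n x)"]
      indep_vars_lebesgue_integral[of "{1..N}" "\<lambda>n x. ?f n (\<omega> n x)"] by auto
  from *(1) show "integrable Q (\<lambda>x. \<Prod>n=1..N. if n \<in> A then \<phi> (\<omega> n x) else \<psi> (\<omega> n x))" .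
  have "(\<Prod>n=1..N. \<integral>x. ?f n (\<omega> n x) \<partial>Q)
      = (\<Prod>n\<in>{1..N}. if n \<in> A then (\<integral>x. \<phi> (\<omega> 1 x) \<partial>Q) else (\<integral>x. \<psi> (\<omega> 1 x) \<partial>Q))"
  proof (rule prod.cong)
    fix n assume "n \<in> {1..N}"
    then have "1 \<le> n" by simp
    note eqs = identically_distributed_integral(2)[OF assms(1) this] identically_distributed_integral(2)[OF assms(2) this]
    show "(\<integral>x. ?f n (\<omega> n x) \<partial>Q) = (if n \<in> A then (\<integral>x. \<phi> (\<omega> 1 x) \<partial>Q) else (\<integral>x. \<psi> (\<omega> 1 x) \<partial>Q))"
      by (cases "n \<in> A") (simp_all only: if_True if_False eqs)
  qed simp
  also have "\<dots> = (\<integral>x. \<phi> (\<omega> 1 x) \<partial>Q) ^ card ({1..N} \<inter> A) * (\<integral>x. \<psi> (\<omega> 1 x) \<partial>Q) ^ card ({1..N} \<inter> - A)"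
    by (subst prod.If_cases) auto
  also have "{1..N} \<inter> A = A" using A by auto
  also have "{1..N} \<inter> - A = {1..N} - A" by auto
  also have "card ({1..N} - A) = N - card A"
    using A by (subst card_Diff_subset) (auto intro: finite_subset)
  finally show "(\<integral>x. (\<Prod>n=1..N. if n \<in> A then \<phi> (\<omega> n x) else \<psi> (\<omega> n x)) \<partial>Q)
       = (\<integral>x. \<phi> (\<omega> 1 x) \<partial>Q) ^ card A * (\<integral>x. \<psi> (\<omega> 1 x) \<partial>Q) ^ (N - card A)"
    using *(2) by simp
qed

text \<open>
  The filtration generated by the environment, taken as the preimage of the product
  sigma-algebra on the first \<open>n\<close> sites: an event of the past is then literally a condition
  on the restricted environment, to which independence of disjoint blocks of sites applies.
\<close>

definition history :: "nat \<Rightarrow> 'b measure" where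
  "history n = vimage_algebra (space Q) (\<lambda>x. \<lambda>i\<in>{1..n}. \<omega> i x) (PiM {1..n} (\<lambda>_. borel))"

lemma history_map_measurable: "(\<lambda>x. \<lambda>i\<in>{1..n}. \<omega> i x) \<in> measurable Q (PiM {1..n} (\<lambda>_. borel))"
  by (intro measurable_restrict omega_measurable) simp

lemma history_subalgebra: "subalgebra Q (history n)"
proof -
  have "sets (history n) \<subseteq> sets Q"
    unfolding history_def
    using measurable_sets[OF history_map_measurable[of n]] history_map_measurable[of n]
    by (auto simp: sets_vimage_algebra2 space_PiM)
  then show ?thesis by (auto simp: subalgebra_def history_def)
qed

lemma omega_history_measurable: "i \<in> {1..n} \<Longrightarrow> \<omega> i \<in> borel_measurable (history n)"
proof -
  assume i: "i \<in> {1..n}"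
  have "(\<lambda>x. \<lambda>i\<in>{1..n}. \<omega> i x) \<in> measurable (history n) (PiM {1..n} (\<lambda>_. borel))"
    unfolding history_def by (intro measurable_vimage_algebra1) (auto simp: space_PiM)
  from measurable_compose[OF this measurable_component_singleton[OF i]]
  show ?thesis using i by simp
qed

lemma history_mono: "sets (history n) \<subseteq> sets (history (Suc n))"
proof -
  have "(\<lambda>x. \<lambda>i\<in>{1..n}. \<omega> i x) \<in> measurable (history (Suc n)) (PiM {1..n} (\<lambda>_. borel))"
    by (intro measurable_restrict omega_history_measurable) simp
  from measurable_sets[OF this] show ?thesis
    unfolding history_def[of n] by (auto simp: sets_vimage_algebra2 space_PiM) (simp add: history_def)
qed

text \<open>
  This is the one step of the martingale property: the factor at the next site is independent
  of everything expressed through the first \<open>n\<close> sites.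
\<close>

lemma fresh_site_independent:
  fixes \<phi> :: "real \<Rightarrow> real"
  assumes [measurable]: "\<phi> \<in> borel_measurable borel" and int: "integrable Q (\<lambda>x. \<phi> (\<omega> 1 x))"
    and A: "A \<subseteq> {1..n}" and B: "B \<in> sets (history n)"
  shows "(\<integral>x. indicator B x * (\<Prod>i\<in>A. \<phi> (\<omega> i x)) * \<phi> (\<omega> (Suc n) x) \<partial>Q)
       = (\<integral>x. indicator B x * (\<Prod>i\<in>A. \<phi> (\<omega> i x)) \<partial>Q) * (\<integral>x. \<phi> (\<omega> 1 x) \<partial>Q)"
    and "integrable Q (\<lambda>x. indicator B x * (\<Prod>i\<in>A. \<phi> (\<omega> i x)))"
    and "integrable Q (\<lambda>x. indicator B x * (\<Prod>i\<in>A. \<phi> (\<omega> i x)) * \<phi> (\<omega> (Suc n) x))"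
proof -
  obtain C where C[measurable]: "C \<in> sets (PiM {1..n} (\<lambda>_. borel))"
    and BC: "B = (\<lambda>x. \<lambda>i\<in>{1..n}. \<omega> i x) -` C \<inter> space Q"
    using B unfolding history_def by (auto simp: sets_vimage_algebra2 space_PiM)
  define g where "g v = indicator C v * (\<Prod>i\<in>A. \<phi> (v i))" for v :: "nat \<Rightarrow> real"
  have "(\<lambda>v. \<phi> (v i)) \<in> borel_measurable (PiM {1..n} (\<lambda>_. borel))" if "i \<in> A" for i
    using measurable_compose[OF measurable_component_singleton[of i "{1..n}" "\<lambda>_. borel"] assms(1)] that A by auto
  then have g[measurable]: "g \<in> borel_measurable (PiM {1..n} (\<lambda>_. borel))"
    unfolding g_def by (intro borel_measurable_times borel_measurable_prod borel_measurable_indicator C)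
  have s: "(\<lambda>v. \<phi> (v (Suc n))) \<in> borel_measurable (PiM {Suc n} (\<lambda>_. borel))"
    by measurable
  have "indep_var borel (g \<circ> (\<lambda>x. \<lambda>i\<in>{1..n}. \<omega> i x)) borel ((\<lambda>v. \<phi> (v (Suc n))) \<circ> (\<lambda>x. \<lambda>i\<in>{Suc n}. \<omega> i x))"
    by (rule indep_var_compose[OF indep_var_restrict[OF omega_indep] g s]) auto
  moreover have "(g \<circ> (\<lambda>x. \<lambda>i\<in>{1..n}. \<omega> i x)) x = g (\<lambda>i\<in>{1..n}. \<omega> i x)" for x by simp
  moreover have "((\<lambda>v. \<phi> (v (Suc n))) \<circ> (\<lambda>x. \<lambda>i\<in>{Suc n}. \<omega> i x)) = (\<lambda>x. \<phi> (\<omega> (Suc n) x))"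
    by (simp add: fun_eq_iff)
  ultimately have ind: "indep_var borel (\<lambda>x. g (\<lambda>i\<in>{1..n}. \<omega> i x)) borel (\<lambda>x. \<phi> (\<omega> (Suc n) x))"
    by (simp add: comp_def)
  have g_eq: "g (\<lambda>i\<in>{1..n}. \<omega> i x) = indicator B x * (\<Prod>i\<in>A. \<phi> (\<omega> i x))" if "x \<in> space Q" for x
  proof -
    have "(\<Prod>i\<in>A. \<phi> ((\<lambda>i\<in>{1..n}. \<omega> i x) i)) = (\<Prod>i\<in>A. \<phi> (\<omega> i x))"
      using A by (intro prod.cong) auto
    then show ?thesis using that by (simp add: g_def BC indicator_def)
  qed
  have P_eq: "(\<Prod>i=1..n. if i \<in> A then \<phi> (\<omega> i x) else 1) = (\<Prod>i\<in>A. \<phi> (\<omega> i x))" for x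
    using A by (subst prod.inter_restrict[symmetric]) (auto simp: Int_absorb1)
  have "integrable Q (\<lambda>x. \<Prod>i=1..n. if i \<in> A then \<phi> (\<omega> i x) else 1)"
    by (rule integrable_site_product[of \<phi> "\<lambda>_. 1", OF assms(1) _ int _ A]) simp_all
  then have P: "integrable Q (\<lambda>x. \<Prod>i\<in>A. \<phi> (\<omega> i x))" unfolding P_eq .
  have "B \<in> sets Q" using B history_subalgebra[of n] by (auto simp: subalgebra_def)
  from integrable_mult_indicator[OF this P]
  show 1: "integrable Q (\<lambda>x. indicator B x * (\<Prod>i\<in>A. \<phi> (\<omega> i x)))"
    unfolding real_scaleR_def .
  then have 2: "integrable Q (\<lambda>x. g (\<lambda>i\<in>{1..n}. \<omega> i x))"
    by (subst Bochner_Integration.integrable_cong[OF refl g_eq])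
  have 3: "integrable Q (\<lambda>x. \<phi> (\<omega> (Suc n) x))"
    by (rule identically_distributed_integral(1)[OF assms(1), THEN iffD2, OF _ int]) simp
  have "(\<integral>x. indicator B x * (\<Prod>i\<in>A. \<phi> (\<omega> i x)) * \<phi> (\<omega> (Suc n) x) \<partial>Q)
     = (\<integral>x. g (\<lambda>i\<in>{1..n}. \<omega> i x) * \<phi> (\<omega> (Suc n) x) \<partial>Q)"
    using g_eq by (intro Bochner_Integration.integral_cong) auto
  also have "\<dots> = (\<integral>x. g (\<lambda>i\<in>{1..n}. \<omega> i x) \<partial>Q) * (\<integral>x. \<phi> (\<omega> (Suc n) x) \<partial>Q)"
    by (rule indep_var_lebesgue_integral[OF ind 2 3])
  also have "(\<integral>x. g (\<lambda>i\<in>{1..n}. \<omega> i x) \<partial>Q) = (\<integral>x. indicator B x * (\<Prod>i\<in>A. \<phi> (\<omega> i x)) \<partial>Q)"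
    using g_eq by (intro Bochner_Integration.integral_cong) auto
  also have "(\<integral>x. \<phi> (\<omega> (Suc n) x) \<partial>Q) = (\<integral>x. \<phi> (\<omega> 1 x) \<partial>Q)"
    by (rule identically_distributed_integral(2)[OF assms(1)]) simp
  finally show "(\<integral>x. indicator B x * (\<Prod>i\<in>A. \<phi> (\<omega> i x)) * \<phi> (\<omega> (Suc n) x) \<partial>Q)
       = (\<integral>x. indicator B x * (\<Prod>i\<in>A. \<phi> (\<omega> i x)) \<partial>Q) * (\<integral>x. \<phi> (\<omega> 1 x) \<partial>Q)" .
  have "integrable Q (\<lambda>x. g (\<lambda>i\<in>{1..n}. \<omega> i x) * \<phi> (\<omega> (Suc n) x))"
    by (rule indep_var_integrable[OF ind 2 3])
  moreover have "integrable Q (\<lambda>x. g (\<lambda>i\<in>{1..n}. \<omega> i x) * \<phi> (\<omega> (Suc n) x)) \<longleftrightarrow>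
     integrable Q (\<lambda>x. indicator B x * (\<Prod>i\<in>A. \<phi> (\<omega> i x)) * \<phi> (\<omega> (Suc n) x))"
    using g_eq by (intro Bochner_Integration.integrable_cong) auto
  ultimately show "integrable Q (\<lambda>x. indicator B x * (\<Prod>i\<in>A. \<phi> (\<omega> i x)) * \<phi> (\<omega> (Suc n) x))" by simp
qed

end

section \<open>The partition function as a martingale\<close>

locale pinning_model = renewal_process M \<tau> \<alpha> L + env: environment Q \<omega>
  for M :: "'a measure" and \<tau> \<alpha> L and Q :: "'b measure" and \<omega> +
  fixes \<beta> :: real
  assumes beta_pos: "0 < \<beta>"
begin

text \<open>
  The weight of a contact at the critical value of the pinning parameter.
\<close>

definition tilt :: "real \<Rightarrow> real" where
  "tilt v = exp (\<beta> * v - log_mgf Q \<omega> \<beta>)"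

definition Z :: "nat \<Rightarrow> 'b \<Rightarrow> real" where
  "Z N x = partition_function M \<tau> N \<beta> (- log_mgf Q \<omega> \<beta>) (\<lambda>n. \<omega> n x)"

definition Z_lim :: "'b \<Rightarrow> real" where
  "Z_lim x = limit_partition_function M \<tau> Q \<omega> \<beta> x"

lemma tilt_pos [simp]: "0 < tilt v" by (simp add: tilt_def)

lemma tilt_measurable [measurable]: "tilt \<in> borel_measurable borel"
  unfolding tilt_def by measurable

lemma tilt_integrable: "integrable Q (\<lambda>x. tilt (\<omega> 1 x))"
  using env.omega_exp_moments[of \<beta>] beta_pos by (simp add: tilt_def exp_diff)

lemma tilt_mean: "(\<integral>x. tilt (\<omega> 1 x) \<partial>Q) = 1"
proof -
  have "0 < (\<integral>x. exp (\<beta> * \<omega> 1 x) \<partial>Q)"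
    using env.omega_exp_moments[of \<beta>] beta_pos by (intro env.expectation_pos) auto
  then show ?thesis by (simp add: tilt_def exp_diff log_mgf_def)
qed

lemma pinning_weight_eq:
  "pinning_weight \<tau> N \<beta> (- log_mgf Q \<omega> \<beta>) w y = (\<Prod>n\<in>contacts \<tau> N y. tilt (w n))"
proof -
  have "(\<Sum>n=1..N. (- log_mgf Q \<omega> \<beta> + \<beta> * w n) * indicator (renewal_set \<tau> y) n)
      = (\<Sum>n\<in>{1..N}. if n \<in> renewal_set \<tau> y then \<beta> * w n - log_mgf Q \<omega> \<beta> else 0)"
    by (intro sum.cong) auto
  also have "\<dots> = (\<Sum>n\<in>{1..N} \<inter> renewal_set \<tau> y. \<beta> * w n - log_mgf Q \<omega> \<beta>)"
    by (rule sum.inter_restrict[symmetric]) simp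
  finally show ?thesis
    unfolding pinning_weight_def tilt_def contacts_def by (simp add: exp_sum Int_commute)
qed

lemma Z_eq: "Z N x = (\<integral>y. (\<Prod>n\<in>contacts \<tau> N y. tilt (\<omega> n x)) \<partial>M)"
  by (simp add: Z_def partition_function_def pinning_weight_eq)

lemmas integrable_contacts = integrable_finite_range[OF finite_measure_axioms finite_Pow_iff[THEN iffD2, OF finite_atLeastAtMost] contacts_measurable]

lemmas integral_contacts = integral_finite_range(2)[OF finite_measure_axioms finite_Pow_iff[THEN iffD2, OF finite_atLeastAtMost] contacts_measurable]

lemma Z_pos: "0 < Z N x"
  unfolding Z_eq using integrable_contacts by (intro expectation_pos prod_pos) auto

lemma contacts_Fubini:
  fixes \<Phi> :: "nat set \<Rightarrow> 'b \<Rightarrow> real"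
  assumes "\<And>A. A \<subseteq> {1..N} \<Longrightarrow> integrable Q (\<Phi> A)"
  shows "integrable Q (\<lambda>x. \<integral>y. \<Phi> (contacts \<tau> N y) x \<partial>M)"
    and "(\<integral>x. (\<integral>y. \<Phi> (contacts \<tau> N y) x \<partial>M) \<partial>Q) = (\<integral>y. (\<integral>x. \<Phi> (contacts \<tau> N y) x \<partial>Q) \<partial>M)"
proof -
  let ?p = "\<lambda>A. measure M (contacts \<tau> N -` {A} \<inter> space M)"
  have eq: "(\<lambda>x. \<integral>y. \<Phi> (contacts \<tau> N y) x \<partial>M) = (\<lambda>x. \<Sum>A\<in>Pow {1..N}. ?p A * \<Phi> A x)"
    using integral_contacts[where N=N and f="\<lambda>A. \<Phi> A x" for x] by (intro ext)
  have int: "integrable Q (\<lambda>x. ?p A * \<Phi> A x)" if "A \<in> Pow {1..N}" for A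
    using assms that by (intro integrable_mult_right) auto
  show "integrable Q (\<lambda>x. \<integral>y. \<Phi> (contacts \<tau> N y) x \<partial>M)"
    unfolding eq by (intro Bochner_Integration.integrable_sum int)
  show "(\<integral>x. (\<integral>y. \<Phi> (contacts \<tau> N y) x \<partial>M) \<partial>Q) = (\<integral>y. (\<integral>x. \<Phi> (contacts \<tau> N y) x \<partial>Q) \<partial>M)"
    unfolding eq integral_contacts[where N=N and f="\<lambda>A. \<integral>x. \<Phi> A x \<partial>Q"]
    by (subst Bochner_Integration.integral_sum[OF int]) auto
qed

lemma tilt_product:
  assumes A: "A \<subseteq> {1..N}"
  shows "integrable Q (\<lambda>x. \<Prod>n\<in>A. tilt (\<omega> n x))" and "(\<integral>x. (\<Prod>n\<in>A. tilt (\<omega> n x)) \<partial>Q) = 1"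
proof -
  have "(\<lambda>x. \<Prod>n=1..N. if n \<in> A then tilt (\<omega> n x) else 1) = (\<lambda>x. \<Prod>n\<in>A. tilt (\<omega> n x))"
    using A by (intro ext, subst prod.inter_restrict[symmetric]) (auto simp: Int_absorb1)
  note eq = this
  note product = env.site_product[of tilt "\<lambda>_. 1", OF tilt_measurable _ tilt_integrable _ A, unfolded eq]
  show "integrable Q (\<lambda>x. \<Prod>n\<in>A. tilt (\<omega> n x))" by (rule product(1)) simp_all
  show "(\<integral>x. (\<Prod>n\<in>A. tilt (\<omega> n x)) \<partial>Q) = 1"
    by (subst product(2)) (simp_all add: tilt_mean[unfolded One_nat_def] env.prob_space)
qed

text \<open>
  Going from \<open>n\<close> to \<open>Suc n\<close> multiplies the weight of the trajectories with a contact at the new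
  site by a fresh factor of mean one and leaves the other weights unchanged. The decrease is in
  fact an equality.
\<close>

sublocale supermartingale: nonneg_supermartingale Q env.history Z
proof
  show "subalgebra Q (env.history n)" for n by (rule env.history_subalgebra)
  show "sets (env.history n) \<subseteq> sets (env.history (Suc n))" for n by (rule env.history_mono)
  show "0 \<le> Z n x" for n x using Z_pos[of n x] by simp
  have "integrable Q (\<lambda>x. \<integral>y. (\<Prod>n\<in>contacts \<tau> N y. tilt (\<omega> n x)) \<partial>M)" for N
    by (rule contacts_Fubini(1)) (rule tilt_product)
  then show "integrable Q (Z N)" for N by (simp add: Z_eq[abs_def])
  show "Z n \<in> borel_measurable (env.history n)" for n
  proof -
    have eq: "Z n = (\<lambda>x. \<Sum>A\<in>Pow {1..n}. measure M (contacts \<tau> n -` {A} \<inter> space M) * (\<Prod>i\<in>A. tilt (\<omega> i x)))"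
      unfolding Z_eq[abs_def] by (intro ext integral_contacts)
    have "(\<lambda>x. tilt (\<omega> i x)) \<in> borel_measurable (env.history n)" if "i \<in> {1..n}" for i
      by (rule measurable_compose[OF env.omega_history_measurable[OF that] tilt_measurable])
    then show ?thesis
      unfolding eq by (intro borel_measurable_sum borel_measurable_times borel_measurable_const borel_measurable_prod) auto
  qed
  show "(\<integral>x. indicator B x * Z (Suc n) x \<partial>Q) \<le> (\<integral>x. indicator B x * Z n x \<partial>Q)"
    if B: "B \<in> sets (env.history n)" for n B
  proof -
    define W where "W A x = indicator B x * (\<Prod>i\<in>A. tilt (\<omega> i x))" for A x
    have W: "integrable Q (W A) \<and> (\<integral>x. W A x \<partial>Q) = (\<integral>x. W (A \<inter> {1..n}) x \<partial>Q)
        \<and> integrable Q (W (A \<inter> {1..n}))" if A: "A \<subseteq> {1..Suc n}" for A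
    proof -
      let ?A = "A \<inter> {1..n}"
      have old: "integrable Q (W ?A)" unfolding W_def
        by (rule env.fresh_site_independent(2)[OF tilt_measurable tilt_integrable _ B]) simp
      show ?thesis
      proof (cases "Suc n \<in> A")
        case True
        then have A_eq: "A = insert (Suc n) ?A" using A by (auto simp: le_Suc_eq)
        have "(\<Prod>i\<in>A. tilt (\<omega> i x)) = (\<Prod>i\<in>?A. tilt (\<omega> i x)) * tilt (\<omega> (Suc n) x)" for x
          using prod.insert[of ?A "Suc n" "\<lambda>i. tilt (\<omega> i x)"] unfolding A_eq[symmetric] by simp
        then have WA: "W A = (\<lambda>x. indicator B x * (\<Prod>i\<in>?A. tilt (\<omega> i x)) * tilt (\<omega> (Suc n) x))"
          by (intro ext) (simp only: W_def mult.assoc)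
        have "integrable Q (W A)" unfolding WA
          by (rule env.fresh_site_independent(3)[OF tilt_measurable tilt_integrable _ B]) simp
        moreover have "(\<integral>x. W A x \<partial>Q) = (\<integral>x. W ?A x \<partial>Q) * (\<integral>x. tilt (\<omega> 1 x) \<partial>Q)"
          unfolding WA W_def[of ?A]
          by (rule env.fresh_site_independent(1)[OF tilt_measurable tilt_integrable _ B]) simp
        ultimately show ?thesis using old by (simp only: tilt_mean) simp
      next
        case False
        then have "?A = A" using A by (auto simp: le_Suc_eq)
        then show ?thesis using old by simp
      qed
    qed
    have restrict: "contacts \<tau> n y = contacts \<tau> (Suc n) y \<inter> {1..n}" for y by (auto simp: contacts_def)
    have "(\<integral>x. indicator B x * Z (Suc n) x \<partial>Q) = (\<integral>x. (\<integral>y. W (contacts \<tau> (Suc n) y) x \<partial>M) \<partial>Q)"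
      unfolding Z_eq W_def by simp
    also have "\<dots> = (\<integral>y. (\<integral>x. W (contacts \<tau> (Suc n) y) x \<partial>Q) \<partial>M)"
      using W by (intro contacts_Fubini(2)) blast
    also have "\<dots> = (\<integral>y. (\<integral>x. W (contacts \<tau> (Suc n) y \<inter> {1..n}) x \<partial>Q) \<partial>M)"
    proof (rule Bochner_Integration.integral_cong[OF refl])
      fix y
      have "contacts \<tau> (Suc n) y \<subseteq> {1..Suc n}" by (auto simp: contacts_def)
      from W[OF this] show "(\<integral>x. W (contacts \<tau> (Suc n) y) x \<partial>Q) = (\<integral>x. W (contacts \<tau> (Suc n) y \<inter> {1..n}) x \<partial>Q)"
        by blast
    qed
    also have "\<dots> = (\<integral>x. (\<integral>y. W (contacts \<tau> (Suc n) y \<inter> {1..n}) x \<partial>M) \<partial>Q)"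
      using W by (intro contacts_Fubini(2)[symmetric, where \<Phi>="\<lambda>A. W (A \<inter> {1..n})"]) blast
    also have "\<dots> = (\<integral>x. indicator B x * Z n x \<partial>Q)"
      unfolding Z_eq W_def restrict by simp
    finally show ?thesis by simp
  qed
qed

text \<open>
  Only almost sure convergence gives the value of \<open>lim\<close> in the definition of the limiting
  partition function a meaning.
\<close>

lemma AE_tendsto_Z_lim: "AE x in Q. (\<lambda>N. Z N x) \<longlonglongrightarrow> Z_lim x"
  using supermartingale.AE_convergent
proof eventually_elim
  case (elim x)
  then show ?case by (simp add: convergent_LIMSEQ_iff Z_lim_def limit_partition_function_def Z_def)
qed

lemma Z_lim_measurable [measurable]: "Z_lim \<in> borel_measurable Q"
proof -
  have "Z_lim = (\<lambda>x. lim (\<lambda>N. Z N x))"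
    by (simp add: Z_lim_def limit_partition_function_def Z_def fun_eq_iff)
  then show ?thesis using supermartingale.Z_measurable by (simp add: borel_measurable_lim_metric)
qed

lemma pinning_probability:
  "measure (pinning_measure M \<tau> N \<beta> (- log_mgf Q \<omega> \<beta>) (\<lambda>n. \<omega> n x)) {y \<in> space M. P (contacts \<tau> N y)}
   = (\<integral>y. of_bool (P (contacts \<tau> N y)) * (\<Prod>n\<in>contacts \<tau> N y. tilt (\<omega> n x)) \<partial>M) / Z N x"
proof -
  let ?S = "{y \<in> space M. P (contacts \<tau> N y)}"
  let ?w = "\<lambda>y. \<Prod>n\<in>contacts \<tau> N y. tilt (\<omega> n x)"
  let ?f = "\<lambda>A. of_bool (P A) * (\<Prod>n\<in>A. tilt (\<omega> n x)) / Z N x"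
  have S: "?S \<in> sets M"
  proof -
    have "{A \<in> Pow {1..N}. P A} \<in> sets (count_space (Pow {1..N}))" by auto
    from measurable_sets[OF contacts_measurable this] 
    have "contacts \<tau> N -` {A \<in> Pow {1..N}. P A} \<inter> space M \<in> sets M" .
    also have "contacts \<tau> N -` {A \<in> Pow {1..N}. P A} \<inter> space M = ?S" by (auto simp: contacts_def)
    finally show ?thesis .
  qed
  have wm: "(\<lambda>y. ennreal (?w y / Z N x)) \<in> borel_measurable M"
    using borel_measurable_integrable[OF integrable_contacts[where N=N and f="\<lambda>A. \<Prod>n\<in>A. tilt (\<omega> n x)"]]
    by measurable
  have f_nn: "0 \<le> ?f A" for A
    using Z_pos[of N x] by (intro divide_nonneg_nonneg mult_nonneg_nonneg prod_nonneg) (auto simp: less_imp_le)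
  have "emeasure (pinning_measure M \<tau> N \<beta> (- log_mgf Q \<omega> \<beta>) (\<lambda>n. \<omega> n x)) ?S
      = (\<integral>\<^sup>+y. ennreal (?w y / Z N x) * indicator ?S y \<partial>M)"
    unfolding pinning_measure_def pinning_weight_eq Z_def[symmetric]
    by (rule emeasure_density[OF wm S])
  also have "\<dots> = (\<integral>\<^sup>+y. ennreal (?f (contacts \<tau> N y)) \<partial>M)"
    by (intro nn_integral_cong) (auto simp: indicator_def)
  also have "\<dots> = ennreal (\<integral>y. ?f (contacts \<tau> N y) \<partial>M)"
    using f_nn by (intro nn_integral_eq_integral integrable_contacts[where N=N and f="?f"]) auto
  finally have "measure (pinning_measure M \<tau> N \<beta> (- log_mgf Q \<omega> \<beta>) (\<lambda>n. \<omega> n x)) ?S = (\<integral>y. ?f (contacts \<tau> N y) \<partial>M)"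
    unfolding measure_def using f_nn by (simp only: enn2real_ennreal Bochner_Integration.integral_nonneg)
  then show ?thesis by simp
qed

end

section \<open>Strong disorder above the exponent one half\<close>

text \<open>
  The linear term matters: it will be centred, so that inverting a penalty of strength \<open>s\<close> costs
  only order \<open>s\<^sup>2\<close> on average.
\<close>

lemma inverse_one_minus_le:
  fixes t :: real
  assumes "\<bar>t\<bar> \<le> 1/2"
  shows "1 / (1 - t) \<le> 1 + t + 2 * t\<^sup>2"
proof -
  have "0 \<le> t\<^sup>2 * (1 - 2 * t)" using assms by (intro mult_nonneg_nonneg) auto
  also have "\<dots> = (1 + t + 2 * t\<^sup>2) * (1 - t) - 1" by (simp add: power2_eq_square algebra_simps)
  finally have "1 \<le> (1 + t + 2 * t\<^sup>2) * (1 - t)" by simp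
  then show ?thesis using assms by (subst pos_divide_le_eq) auto
qed

lemma sqrt_mult_le_add:
  fixes u v :: real
  assumes "0 \<le> u" "0 \<le> v"
  shows "sqrt (u * v) \<le> u + v"
proof (rule order_trans[OF arith_geo_mean_sqrt[OF assms]])
  show "(u + v) / 2 \<le> u + v" using assms by simp
qed

context pinning_model
begin

text \<open>
  The score is a bounded increasing function of the contact weight. It is chosen such that
  its product with \<open>tilt v - 1\<close> is a nonnegative quotient with numerator \<open>(tilt v - 1)\<^sup>2\<close>.
\<close>

definition score :: "real \<Rightarrow> real" where
  "score v = (tilt v - 1) / (tilt v + 1)"

text \<open>
  The amount by which the mean score at a contact exceeds the mean score at a typical site.
\<close>

definition score_gain :: real where
  "score_gain = (\<integral>x. score (\<omega> 1 x) * (tilt (\<omega> 1 x) - 1) \<partial>Q)"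

lemma omega_1_measurable [measurable]: "\<omega> 1 \<in> borel_measurable Q"
  by (rule env.omega_measurable) simp

lemmas [measurable] = omega_1_measurable[unfolded One_nat_def]

lemma score_measurable [measurable]: "score \<in> borel_measurable borel"
  unfolding score_def by measurable

lemma abs_score_le: "\<bar>score v\<bar> \<le> 1"
proof -
  have "\<bar>tilt v - 1\<bar> \<le> tilt v + 1" "0 < tilt v + 1" "\<bar>tilt v + 1\<bar> = tilt v + 1"
    using tilt_pos[of v] by linarith+
  then show ?thesis by (simp only: score_def abs_divide divide_le_eq_1_pos)
qed

lemma score_integrable: "integrable Q (\<lambda>x. score (\<omega> 1 x))"
  by (rule env.integrable_const_bound[where B=1]) (auto simp: abs_score_le)

lemma score_tilt_integrable: "integrable Q (\<lambda>x. score (\<omega> 1 x) * tilt (\<omega> 1 x))"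
proof (rule Bochner_Integration.integrable_bound[OF tilt_integrable])
  show "AE x in Q. norm (score (\<omega> 1 x) * tilt (\<omega> 1 x)) \<le> norm (tilt (\<omega> 1 x))"
    by (intro AE_I2) (simp add: abs_mult mult_left_le_one_le abs_score_le)
qed measurable

lemma score_gain_eq:
  "score_gain = (\<integral>x. score (\<omega> 1 x) * tilt (\<omega> 1 x) \<partial>Q) - (\<integral>x. score (\<omega> 1 x) \<partial>Q)"
  unfolding score_gain_def right_diff_distrib mult_1_right
  by (rule Bochner_Integration.integral_diff[OF score_tilt_integrable score_integrable])

text \<open>
  The integrand is nonnegative and vanishes only where the contact weight equals one. If that
  happened almost surely, the environment would be constant, against its unit variance.
\<close>

lemma score_gain_pos: "0 < score_gain"
proof -
  let ?g = "\<lambda>x. score (\<omega> 1 x) * (tilt (\<omega> 1 x) - 1)"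
  have g_eq: "?g x = (tilt (\<omega> 1 x) - 1)\<^sup>2 / (tilt (\<omega> 1 x) + 1)" for x
    by (simp add: score_def power2_eq_square)
  have nn: "0 \<le> ?g x" for x
    unfolding g_eq by (intro divide_nonneg_nonneg add_nonneg_nonneg) (auto intro: less_imp_le)
  have int: "integrable Q ?g"
    unfolding right_diff_distrib mult_1_right
    by (rule Bochner_Integration.integrable_diff[OF score_tilt_integrable score_integrable])
  have "score_gain \<noteq> 0"
  proof
    assume "score_gain = 0"
    then have "AE x in Q. ?g x = 0"
      unfolding score_gain_def using integral_nonneg_eq_0_iff_AE[OF int] nn by simp
    then have const: "AE x in Q. \<omega> 1 x = log_mgf Q \<omega> \<beta> / \<beta>"
    proof eventually_elim
      case (elim x)
      moreover have "tilt (\<omega> 1 x) + 1 \<noteq> 0" using tilt_pos[of "\<omega> 1 x"] by linarith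
      ultimately have "tilt (\<omega> 1 x) = 1" unfolding g_eq by simp
      then show ?case using beta_pos by (simp add: tilt_def field_simps)
    qed
    then have "env.expectation (\<omega> 1) = env.expectation (\<lambda>x. log_mgf Q \<omega> \<beta> / \<beta>)"
      by (intro integral_cong_AE) auto
    then have "log_mgf Q \<omega> \<beta> / \<beta> = 0" using env.omega_mean by (simp add: env.prob_space)
    then have "env.variance (\<omega> 1) = env.expectation (\<lambda>x. 0)"
      using const env.omega_mean by (intro integral_cong_AE) auto
    then show False using env.omega_variance by simp
  qed
  moreover have "0 \<le> score_gain"
    unfolding score_gain_def using nn by (intro integral_nonneg_AE) auto
  ultimately show ?thesis by simp
qed

text \<open>
  A factor of mean one at a typical site, but of mean \<open>1 - s * score_gain\<close> under the contact
  weight. For \<open>s \<le> 1/4\<close> it stays above one half, because the centred score is at most two.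
\<close>

definition penalty :: "real \<Rightarrow> real \<Rightarrow> real" where
  "penalty s v = 1 - s * (score v - (\<integral>x. score (\<omega> 1 x) \<partial>Q))"

lemma penalty_measurable [measurable]: "penalty s \<in> borel_measurable borel"
  unfolding penalty_def by measurable

lemma centred_score_le: "\<bar>score v - (\<integral>x. score (\<omega> 1 x) \<partial>Q)\<bar> \<le> 2"
proof -
  have "\<bar>\<integral>x. score (\<omega> 1 x) \<partial>Q\<bar> \<le> (\<integral>x. 1 \<partial>Q)"
    using score_integrable abs_score_le
    by (intro order_trans[OF integral_abs_bound] integral_mono) auto
  then show ?thesis using abs_score_le[of v] by (simp add: env.prob_space)
qed

lemma penalty_deviation:
  assumes s: "0 \<le> s" "s \<le> 1/4"
  shows "\<bar>s * (score v - (\<integral>x. score (\<omega> 1 x) \<partial>Q))\<bar> \<le> 1/2"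
proof -
  have "s * \<bar>score v - (\<integral>x. score (\<omega> 1 x) \<partial>Q)\<bar> \<le> 1/4 * 2"
    using s centred_score_le by (intro mult_mono) auto
  then show ?thesis using s by (simp add: abs_mult)
qed

lemma penalty_ge: "0 \<le> s \<Longrightarrow> s \<le> 1/4 \<Longrightarrow> 1/2 \<le> penalty s v"
  using penalty_deviation[of s v] unfolding penalty_def by linarith

lemma penalty_integrable: "integrable Q (\<lambda>x. penalty s (\<omega> 1 x))"
  unfolding penalty_def using score_integrable by simp

lemma penalty_mean: "(\<integral>x. penalty s (\<omega> 1 x) \<partial>Q) = 1"
  unfolding penalty_def using score_integrable by (simp add: env.prob_space)

lemma tilt_penalty:
  shows "integrable Q (\<lambda>x. tilt (\<omega> 1 x) * penalty s (\<omega> 1 x))"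
    and "(\<integral>x. tilt (\<omega> 1 x) * penalty s (\<omega> 1 x) \<partial>Q) = 1 - s * score_gain"
proof -
  let ?m = "\<integral>x. score (\<omega> 1 x) \<partial>Q"
  have eq: "tilt v * penalty s v = (1 + s * ?m) * tilt v - s * (score v * tilt v)" for v
    by (simp add: penalty_def algebra_simps)
  show "integrable Q (\<lambda>x. tilt (\<omega> 1 x) * penalty s (\<omega> 1 x))"
    unfolding eq by (intro Bochner_Integration.integrable_diff integrable_mult_right tilt_integrable score_tilt_integrable)
  have "(\<integral>x. tilt (\<omega> 1 x) * penalty s (\<omega> 1 x) \<partial>Q)
      = (\<integral>x. (1 + s * ?m) * tilt (\<omega> 1 x) \<partial>Q) - (\<integral>x. s * (score (\<omega> 1 x) * tilt (\<omega> 1 x)) \<partial>Q)"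
    unfolding eq by (intro Bochner_Integration.integral_diff integrable_mult_right tilt_integrable score_tilt_integrable)
  also have "\<dots> = 1 - s * score_gain"
    unfolding score_gain_eq integral_mult_right_zero tilt_mean by (simp add: algebra_simps)
  finally show "(\<integral>x. tilt (\<omega> 1 x) * penalty s (\<omega> 1 x) \<partial>Q) = 1 - s * score_gain" .
qed

text \<open>
  The first order term in \<open>s\<close> has mean zero, which leaves a cost of second order.
\<close>

lemma inverse_penalty:
  assumes s: "0 \<le> s" "s \<le> 1/4"
  shows "integrable Q (\<lambda>x. 1 / penalty s (\<omega> 1 x))"
    and "(\<integral>x. 1 / penalty s (\<omega> 1 x) \<partial>Q) \<le> 1 + 8 * s\<^sup>2"
proof -
  let ?m = "\<integral>x. score (\<omega> 1 x) \<partial>Q"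
  have ge: "1/2 \<le> penalty s v" for v using penalty_ge s .
  have "norm (1 / penalty s v) \<le> 2" for v
  proof -
    have "0 < penalty s v" using ge[of v] by linarith
    then show ?thesis using ge[of v] by (simp add: field_simps)
  qed
  then show int: "integrable Q (\<lambda>x. 1 / penalty s (\<omega> 1 x))"
    by (intro env.integrable_const_bound[where B=2]) auto
  have le: "1 / penalty s v \<le> 1 + s * (score v - ?m) + 8 * s\<^sup>2" for v
  proof -
    let ?t = "s * (score v - ?m)"
    have "1 / penalty s v \<le> 1 + ?t + 2 * ?t\<^sup>2"
      unfolding penalty_def by (rule inverse_one_minus_le) (rule penalty_deviation[OF s])
    also have "(score v - ?m)\<^sup>2 \<le> 2\<^sup>2" 
      using centred_score_le[of v] abs_le_square_iff[of "score v - ?m" 2] by simp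
    then have "?t\<^sup>2 \<le> s\<^sup>2 * 4" by (simp add: power_mult_distrib mult_left_mono)
    finally show ?thesis by simp
  qed
  have "(\<integral>x. 1 / penalty s (\<omega> 1 x) \<partial>Q) \<le> (\<integral>x. 1 + s * (score (\<omega> 1 x) - ?m) + 8 * s\<^sup>2 \<partial>Q)"
    using int score_integrable le by (intro integral_mono) auto
  also have "\<dots> = 1 + 8 * s\<^sup>2" using score_integrable by (simp add: env.prob_space)
  finally show "(\<integral>x. 1 / penalty s (\<omega> 1 x) \<partial>Q) \<le> 1 + 8 * s\<^sup>2" .
qed

text \<open>
  With a penalty at every site, contacts contribute \<open>1 - s * score_gain\<close> each and the other
  sites contribute one.
\<close>

lemma penalised_Z:
  defines "G \<equiv> \<lambda>N s x. \<Prod>n=1..N. penalty s (\<omega> n x)"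
  shows "integrable Q (\<lambda>x. Z N x * G N s x)"
    and "(\<integral>x. Z N x * G N s x \<partial>Q) = (\<integral>y. (1 - s * score_gain) ^ card (contacts \<tau> N y) \<partial>M)"
proof -
  let ?\<Phi> = "\<lambda>A x. \<Prod>n=1..N. if n \<in> A then tilt (\<omega> n x) * penalty s (\<omega> n x) else penalty s (\<omega> n x)"
  have \<Phi>: "integrable Q (?\<Phi> A)" "(\<integral>x. ?\<Phi> A x \<partial>Q) = (1 - s * score_gain) ^ card A" if A: "A \<subseteq> {1..N}" for A
  proof -
    have m: "(\<lambda>v. tilt v * penalty s v) \<in> borel_measurable borel" by measurable
    note product = env.site_product[OF m penalty_measurable tilt_penalty(1) penalty_integrable A]
    show "integrable Q (?\<Phi> A)" by (rule product(1))
    show "(\<integral>x. ?\<Phi> A x \<partial>Q) = (1 - s * score_gain) ^ card A"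
      unfolding product(2) tilt_penalty(2) penalty_mean by simp
  qed
  have split: "(\<Prod>n\<in>A. tilt (\<omega> n x)) * G N s x = ?\<Phi> A x" if A: "A \<subseteq> {1..N}" for A x
  proof -
    have "?\<Phi> A x = (\<Prod>n=1..N. (if n \<in> A then tilt (\<omega> n x) else 1) * penalty s (\<omega> n x))"
      by (intro prod.cong) auto
    also have "\<dots> = (\<Prod>n\<in>{1..N} \<inter> A. tilt (\<omega> n x)) * G N s x"
      unfolding G_def prod.distrib by (subst prod.inter_restrict) simp_all
    also have "{1..N} \<inter> A = A" using A by auto
    finally show ?thesis by simp
  qed
  have sub: "contacts \<tau> N y \<subseteq> {1..N}" for y by (auto simp: contacts_def)
  have eq: "Z N x * G N s x = (\<integral>y. ?\<Phi> (contacts \<tau> N y) x \<partial>M)" for x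
    unfolding Z_eq split[OF sub, symmetric] by simp
  show "integrable Q (\<lambda>x. Z N x * G N s x)"
    unfolding eq by (rule contacts_Fubini(1)[OF \<Phi>(1)])
  show "(\<integral>x. Z N x * G N s x \<partial>Q) = (\<integral>y. (1 - s * score_gain) ^ card (contacts \<tau> N y) \<partial>M)"
    unfolding eq by (subst contacts_Fubini(2)[where \<Phi>="?\<Phi>", OF \<Phi>(1)]) (simp_all only: \<Phi>(2)[OF sub])
qed

text \<open>
  The total cost of the penalties is bounded uniformly in \<open>N\<close> because \<open>N * s\<^sup>2 = 1\<close>; the condition
  \<open>16 \<le> N\<close> is \<open>s \<le> 1/4\<close>.
\<close>

lemma inverse_penalties:
  assumes N: "16 \<le> N"
  defines "s \<equiv> 1 / sqrt (real N)"
  shows "integrable Q (\<lambda>x. \<Prod>n=1..N. 1 / penalty s (\<omega> n x))"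
    and "(\<integral>x. (\<Prod>n=1..N. 1 / penalty s (\<omega> n x)) \<partial>Q) \<le> exp 8"
proof -
  have "sqrt 16 \<le> sqrt (real N)" using N by (intro real_sqrt_le_mono) simp
  then have "4 \<le> sqrt (real N)" by simp
  then have s: "0 \<le> s" "s \<le> 1/4" unfolding s_def using frac_le[of 1 1 4 "sqrt (real N)"] by auto
  have s2: "s\<^sup>2 = 1 / real N" by (simp add: s_def power_divide)
  have m: "(\<lambda>v. 1 / penalty s v) \<in> borel_measurable borel" by measurable
  note product = env.site_product[OF m borel_measurable_const inverse_penalty(1)[OF s] _ subset_refl, of 1 N]
  have eq: "(\<lambda>x. \<Prod>n=1..N. if n \<in> {1..N} then 1 / penalty s (\<omega> n x) else 1) = (\<lambda>x. \<Prod>n=1..N. 1 / penalty s (\<omega> n x))"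
    by (intro ext prod.cong) auto
  show "integrable Q (\<lambda>x. \<Prod>n=1..N. 1 / penalty s (\<omega> n x))"
    using product(1) unfolding eq by simp
  have "(\<integral>x. (\<Prod>n=1..N. 1 / penalty s (\<omega> n x)) \<partial>Q) = (\<integral>x. 1 / penalty s (\<omega> 1 x) \<partial>Q) ^ N"
    using product(2) unfolding eq by simp
  also have "\<dots> \<le> (1 + 8 * s\<^sup>2) ^ N"
  proof (intro power_mono inverse_penalty(2)[OF s])
    have "0 \<le> 1 / penalty s v" for v using penalty_ge[OF s, of v] by simp
    then show "0 \<le> (\<integral>x. 1 / penalty s (\<omega> 1 x) \<partial>Q)" by (intro integral_nonneg_AE) auto
  qed
  also have "\<dots> \<le> exp (8 * s\<^sup>2) ^ N"
    by (intro power_mono exp_ge_add_one_self) auto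
  also have "\<dots> = exp 8" using N by (simp add: s2 exp_of_nat_mult[symmetric])
  finally show "(\<integral>x. (\<Prod>n=1..N. 1 / penalty s (\<omega> n x)) \<partial>Q) \<le> exp 8" .
qed

text \<open>
  With \<open>G\<close> the product of the penalties, the arithmetic-geometric mean inequality bounds the
  square root of \<open>Z\<close> by \<open>c * (Z * G) + 1 / (c * G)\<close>. The mean of \<open>Z * G\<close> is small by
  \<open>penalised_Z\<close>: either there are at most \<open>N powr \<eta>\<close> contacts, or the penalties of more than that
  many contacts multiply to something exponentially small. The free constant \<open>c\<close> later makes the
  bounded mean of \<open>1 / G\<close> negligible.
\<close>

lemma truncated_root_bound:
  assumes N: "16 \<le> N" and c: "0 < c"
  shows "(\<integral>x. min 1 (sqrt (Z N x)) \<partial>Q)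
    \<le> c * (prob {y \<in> space M. real (card (contacts \<tau> N y)) \<le> real N powr \<eta>}
          + exp (- score_gain * real N powr (\<eta> - 1/2))) + exp 8 / c"
proof -
  define s where "s = 1 / sqrt (real N)"
  have "sqrt 16 \<le> sqrt (real N)" using N by (intro real_sqrt_le_mono) simp
  then have "4 \<le> sqrt (real N)" by simp
  then have s: "0 \<le> s" "s \<le> 1/4" unfolding s_def using frac_le[of 1 1 4 "sqrt (real N)"] by auto
  let ?G = "\<lambda>x. \<Prod>n=1..N. penalty s (\<omega> n x)"
  let ?H = "\<lambda>x. \<Prod>n=1..N. 1 / penalty s (\<omega> n x)"
  let ?r = "1 - s * score_gain"
  let ?few = "{y \<in> space M. real (card (contacts \<tau> N y)) \<le> real N powr \<eta>}"
  have pen: "0 < penalty s v" for v using penalty_ge[OF s, of v] by linarith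
  have G: "0 < ?G x" for x using pen by (intro prod_pos) auto
  have GH: "?G x * ?H x = 1" for x
    unfolding prod.distrib[symmetric] using pen by (intro prod.neutral) (auto simp: less_imp_neq[symmetric])
  have H: "0 < ?H x" for x using pen by (intro prod_pos) auto
  have point: "min 1 (sqrt (Z N x)) \<le> c * (Z N x * ?G x) + ?H x / c" for x
  proof -
    have a: "0 \<le> c * (Z N x * ?G x)" "0 \<le> ?H x / c"
      using c Z_pos[of N x] G[of x] H[of x] by (auto intro!: mult_nonneg_nonneg divide_nonneg_nonneg less_imp_le)
    have eq: "(c * (Z N x * ?G x)) * (?H x / c) = Z N x"
    proof -
      have "(c * (Z N x * ?G x)) * (?H x / c) = Z N x * (?G x * ?H x)" using c by (simp only: times_divide_eq_right) simp
      then show ?thesis unfolding GH by simp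
    qed
    have "sqrt (Z N x) \<le> c * (Z N x * ?G x) + ?H x / c"
      using sqrt_mult_le_add[OF a] unfolding eq .
    then show ?thesis by (rule min.coboundedI2)
  qed
  have r_nonneg: "0 \<le> ?r"
    unfolding tilt_penalty(2)[symmetric]
    using pen by (intro integral_nonneg_AE AE_I2 mult_nonneg_nonneg) (auto intro: less_imp_le)
  have r_le: "?r \<le> 1" using s score_gain_pos by simp
  have few_sets: "?few \<in> sets M" by measurable
  have power_le: "?r ^ card (contacts \<tau> N y)
      \<le> indicator ?few y + exp (- score_gain * real N powr (\<eta> - 1/2))" if y: "y \<in> space M" for y
  proof (cases "y \<in> ?few")
    case True
    have "?r ^ card (contacts \<tau> N y) \<le> 1" using r_nonneg r_le by (rule power_le_one)
    then show ?thesis using True by (simp add: add_increasing2)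
  next
    case False
    then have many: "real N powr \<eta> \<le> real (card (contacts \<tau> N y))" using y by auto
    have "?r ^ card (contacts \<tau> N y) \<le> exp (- (s * score_gain)) ^ card (contacts \<tau> N y)"
      using exp_ge_add_one_self[of "- (s * score_gain)"] r_nonneg by (intro power_mono) auto
    also have "\<dots> = exp (- (s * score_gain) * real (card (contacts \<tau> N y)))"
      by (rule exp_of_nat2_mult[symmetric])
    also have "\<dots> \<le> exp (- (s * score_gain) * real N powr \<eta>)"
      using many s score_gain_pos by (simp add: mult_left_mono)
    also have "s * real N powr \<eta> = real N powr (\<eta> - 1/2)"
      using N by (simp add: s_def powr_diff powr_half_sqrt)
    then have "- (s * score_gain) * real N powr \<eta> = - score_gain * real N powr (\<eta> - 1/2)"
      by (simp add: mult.assoc mult.left_commute mult.commute)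
    finally show ?thesis using False by simp
  qed
  have r_int: "integrable M (\<lambda>y. ?r ^ card (contacts \<tau> N y))"
    using integrable_contacts[where N=N and f="\<lambda>A. ?r ^ card A"] .
  have "(\<integral>x. Z N x * ?G x \<partial>Q) = (\<integral>y. ?r ^ card (contacts \<tau> N y) \<partial>M)" by (rule penalised_Z(2))
  also have "\<dots> \<le> (\<integral>y. indicator ?few y + exp (- score_gain * real N powr (\<eta> - 1/2)) \<partial>M)"
    by (intro integral_mono r_int power_le Bochner_Integration.integrable_add integrable_real_indicator few_sets)
       (simp_all add: emeasure_eq_measure)
  also have "\<dots> = prob ?few + exp (- score_gain * real N powr (\<eta> - 1/2))"
    using few_sets by (simp add: prob_space emeasure_eq_measure)
  finally have ZG: "(\<integral>x. Z N x * ?G x \<partial>Q) \<le> prob ?few + exp (- score_gain * real N powr (\<eta> - 1/2))" .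
  have ZG_int: "integrable Q (\<lambda>x. Z N x * ?G x)" by (rule penalised_Z(1))
  have H_int: "integrable Q ?H" and H_le: "(\<integral>x. ?H x \<partial>Q) \<le> exp 8"
    using inverse_penalties[OF N] unfolding s_def by auto
  have "(\<integral>x. min 1 (sqrt (Z N x)) \<partial>Q) \<le> (\<integral>x. c * (Z N x * ?G x) + ?H x / c \<partial>Q)"
  proof (rule integral_mono)
    show "integrable Q (\<lambda>x. min 1 (sqrt (Z N x)))"
    proof (rule env.integrable_const_bound[where B=1])
      show "AE x in Q. norm (min 1 (sqrt (Z N x))) \<le> 1"
        using Z_pos[of N] by (intro AE_I2) (simp add: less_imp_le)
      show "(\<lambda>x. min 1 (sqrt (Z N x))) \<in> borel_measurable Q"
        using supermartingale.Z_measurable[of N] by measurable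
    qed
  qed (use ZG_int H_int point in auto)
  also have "\<dots> = c * (\<integral>x. Z N x * ?G x \<partial>Q) + (\<integral>x. ?H x \<partial>Q) / c"
    using ZG_int H_int by simp
  also have "\<dots> \<le> c * (prob ?few + exp (- score_gain * real N powr (\<eta> - 1/2))) + exp 8 / c"
    using ZG H_le c by (intro add_mono mult_left_mono divide_right_mono) auto
  finally show ?thesis .
qed

text \<open>
  For \<open>\<alpha> > 1/2\<close> an exponent \<open>\<eta> > 1/2\<close> exists for which fewer than \<open>N powr \<eta>\<close> contacts are
  unlikely, so the bound on the truncated square root tends to \<open>exp 8 / c\<close> for every \<open>c\<close>. Its
  limit is the corresponding mean for \<open>Z_lim\<close> by dominated convergence.
\<close>

theorem strong_disorder:
  assumes "1/2 < \<alpha>"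
  shows "AE x in Q. Z_lim x = 0"
proof -
  obtain \<eta> where \<eta>: "1/2 < \<eta>" "\<eta> < min \<alpha> 1" using dense[of "1/2" "min \<alpha> 1"] assms by auto
  let ?I = "\<lambda>x. min 1 (sqrt (Z_lim x))"
  have Z_nn: "0 \<le> Z N x" for N x using Z_pos less_imp_le by blast
  have meas: "(\<lambda>x. min 1 (sqrt (Z N x))) \<in> borel_measurable Q" for N
    using supermartingale.Z_measurable by measurable
  have lim: "(\<lambda>N. \<integral>x. min 1 (sqrt (Z N x)) \<partial>Q) \<longlonglongrightarrow> (\<integral>x. ?I x \<partial>Q)"
  proof (rule integral_dominated_convergence[where w="\<lambda>_. 1"])
    show "AE x in Q. (\<lambda>N. min 1 (sqrt (Z N x))) \<longlonglongrightarrow> ?I x"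
      using AE_tendsto_Z_lim by eventually_elim (intro tendsto_min tendsto_const tendsto_real_sqrt)
    show "AE x in Q. norm (min 1 (sqrt (Z N x))) \<le> 1" for N
      using Z_nn by (intro AE_I2) auto
  qed (use meas in auto)
  have nn: "AE x in Q. 0 \<le> Z_lim x"
    using AE_tendsto_Z_lim
  proof eventually_elim
    case (elim x)
    then show ?case using Z_nn by (intro LIMSEQ_le_const) auto
  qed
  let ?b = "\<lambda>N. prob {y \<in> space M. real (card (contacts \<tau> N y)) \<le> real N powr \<eta>}
          + exp (- score_gain * real N powr (\<eta> - 1/2))"
  have "filterlim (\<lambda>N. exp ((\<eta> - 1/2) * ln (real N))) at_top sequentially"
    using \<eta> by (intro filterlim_compose[OF exp_at_top] filterlim_tendsto_pos_mult_at_top[OF tendsto_const]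
      filterlim_compose[OF ln_at_top] filterlim_real_sequentially) auto
  moreover have "\<forall>\<^sub>F N in sequentially. exp ((\<eta> - 1/2) * ln (real N)) = real N powr (\<eta> - 1/2)"
    using eventually_gt_at_top[of 0] by eventually_elim (simp add: powr_def)
  ultimately have "filterlim (\<lambda>N. real N powr (\<eta> - 1/2)) at_top sequentially"
    by (rule filterlim_mono_eventually[OF _ order_refl order_refl])
  then have "filterlim (\<lambda>N. - score_gain * real N powr (\<eta> - 1/2)) at_bot sequentially"
    using score_gain_pos by (intro filterlim_tendsto_neg_mult_at_bot[OF tendsto_const]) auto
  then have "(\<lambda>N. exp (- score_gain * real N powr (\<eta> - 1/2))) \<longlonglongrightarrow> 0"
    by (rule filterlim_compose[OF exp_at_bot])
  then have b: "?b \<longlonglongrightarrow> 0 + 0"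
    using \<eta> by (intro tendsto_add few_contacts_unlikely) auto
  have le: "(\<integral>x. ?I x \<partial>Q) \<le> exp 8 / c" if c: "0 < c" for c
  proof -
    have "(\<lambda>N. c * ?b N + exp 8 / c) \<longlonglongrightarrow> c * (0 + 0) + exp 8 / c"
      by (intro tendsto_intros b)
    then have "(\<lambda>N. c * ?b N + exp 8 / c) \<longlonglongrightarrow> exp 8 / c" by simp
    from LIMSEQ_le[OF lim this] show ?thesis using truncated_root_bound[OF _ c, of _ \<eta>] by blast
  qed
  have "((\<lambda>c. exp 8 / c) \<longlongrightarrow> (0::real)) at_top"
    by (intro tendsto_divide_0[OF tendsto_const] filterlim_at_top_imp_at_infinity filterlim_ident)
  then have "(\<integral>x. ?I x \<partial>Q) \<le> 0"
    by (rule tendsto_lowerbound) (use le in \<open>auto intro: eventually_mono[OF eventually_gt_at_top[of 0]]\<close>)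
  moreover have I_nn: "AE x in Q. 0 \<le> ?I x" using nn by eventually_elim auto
  moreover have "0 \<le> (\<integral>x. ?I x \<partial>Q)" using I_nn by (rule integral_nonneg_AE)
  ultimately have I_zero: "(\<integral>x. ?I x \<partial>Q) = 0" by linarith
  have "integrable Q ?I"
  proof (rule env.integrable_const_bound[where B=1])
    show "AE x in Q. norm (?I x) \<le> 1" using nn by eventually_elim auto
  qed measurable
  from integral_nonneg_eq_0_iff_AE[OF this I_nn] have "AE x in Q. ?I x = 0" using I_zero by simp
  then show ?thesis by eventually_elim (auto simp: min_def split: if_splits)
qed

end

section \<open>Contacts under weak disorder\<close>

context pinning_model
begin

text \<open>
  The pinning probability \<open>R\<close> of few contacts is a quotient whose numerator has vanishing mean.
  Small denominators are controlled by a continuous function of \<open>Z\<close>, to which almost sure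
  convergence applies directly.
\<close>

theorem many_contacts:
  assumes pos: "AE x in Q. 0 < Z_lim x" and \<gamma>: "\<gamma> < \<alpha>" "\<gamma> < 1"
  shows "(\<lambda>N. \<integral>x. measure (pinning_measure M \<tau> N \<beta> (- log_mgf Q \<omega> \<beta>) (\<lambda>n. \<omega> n x))
                    {y \<in> space M. real N powr \<gamma> < real (card (contacts \<tau> N y))} \<partial>Q) \<longlonglongrightarrow> 1"
proof -
  define few where "few N A \<longleftrightarrow> real (card A) \<le> real N powr \<gamma>" for N and A :: "nat set"
  define B where "B N x = (\<integral>y. of_bool (few N (contacts \<tau> N y)) * (\<Prod>n\<in>contacts \<tau> N y. tilt (\<omega> n x)) \<partial>M)" for N x
  define p where "p N = prob {y \<in> space M. real (card (contacts \<tau> N y)) \<le> real N powr \<gamma>}" for N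
  have p_lim: "p \<longlonglongrightarrow> 0" unfolding p_def by (rule few_contacts_unlikely[OF \<gamma>])
  have tilt_nn: "0 \<le> (\<Prod>n\<in>A. tilt (\<omega> n x))" for A x by (intro prod_nonneg) (simp add: less_imp_le)
  have B_nn: "0 \<le> B N x" for N x
    unfolding B_def using tilt_nn by (intro integral_nonneg_AE AE_I2) auto
  have B_le: "B N x \<le> Z N x" for N x
    unfolding B_def Z_eq using tilt_nn
    by (intro integral_mono integrable_contacts[where f="\<lambda>A. of_bool (few N A) * (\<Prod>n\<in>A. tilt (\<omega> n x))" and N=N]
        integrable_contacts[where f="\<lambda>A. \<Prod>n\<in>A. tilt (\<omega> n x)" and N=N]) auto
  have B_int: "integrable Q (B N)" for N
    unfolding B_def by (intro contacts_Fubini(1)[where \<Phi>="\<lambda>A x. of_bool (few N A) * (\<Prod>n\<in>A. tilt (\<omega> n x))"]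
      integrable_mult_right tilt_product)
  have B_mean: "(\<integral>x. B N x \<partial>Q) = p N" for N
  proof -
    have "(\<integral>x. B N x \<partial>Q) = (\<integral>y. (\<integral>x. of_bool (few N (contacts \<tau> N y)) * (\<Prod>n\<in>contacts \<tau> N y. tilt (\<omega> n x)) \<partial>Q) \<partial>M)"
      unfolding B_def by (intro contacts_Fubini(2)[where \<Phi>="\<lambda>A x. of_bool (few N A) * (\<Prod>n\<in>A. tilt (\<omega> n x))"]
        integrable_mult_right tilt_product)
    also have "\<dots> = (\<integral>y. indicator {y \<in> space M. real (card (contacts \<tau> N y)) \<le> real N powr \<gamma>} y \<partial>M)"
    proof (rule Bochner_Integration.integral_cong[OF refl])
      fix y assume y: "y \<in> space M"
      have "(\<integral>x. (\<Prod>n\<in>contacts \<tau> N y. tilt (\<omega> n x)) \<partial>Q) = 1"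
        by (rule tilt_product(2)[of _ N]) (auto simp: contacts_def)
      then show "(\<integral>x. of_bool (few N (contacts \<tau> N y)) * (\<Prod>n\<in>contacts \<tau> N y. tilt (\<omega> n x)) \<partial>Q)
          = indicator {y \<in> space M. real (card (contacts \<tau> N y)) \<le> real N powr \<gamma>} y"
        using y by (simp add: few_def indicator_def)
    qed
    also have "\<dots> = p N" unfolding p_def by simp
    finally show ?thesis .
  qed
  define R where "R N x = B N x / Z N x" for N x
  have R_nn: "0 \<le> R N x" for N x
    unfolding R_def using B_nn Z_pos by (simp add: less_imp_le)
  have R_le1: "R N x \<le> 1" for N x unfolding R_def using B_le[of N x] Z_pos[of N x] by simp
  have R_meas: "R N \<in> borel_measurable Q" for N
    unfolding R_def using B_int[of N] supermartingale.Z_measurable[of N] by measurable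
  have R_int: "integrable Q (R N)" for N
    using R_nn R_le1 R_meas by (intro env.integrable_const_bound[where B=1]) auto
  have prob_eq: "measure (pinning_measure M \<tau> N \<beta> (- log_mgf Q \<omega> \<beta>) (\<lambda>n. \<omega> n x))
                    {y \<in> space M. real N powr \<gamma> < real (card (contacts \<tau> N y))} = 1 - R N x" for N x
  proof -
    let ?w = "\<lambda>y. \<Prod>n\<in>contacts \<tau> N y. tilt (\<omega> n x)"
    have "(\<integral>y. of_bool (real N powr \<gamma> < real (card (contacts \<tau> N y))) * ?w y \<partial>M)
        = (\<integral>y. ?w y - of_bool (few N (contacts \<tau> N y)) * ?w y \<partial>M)"
      by (intro Bochner_Integration.integral_cong) (auto simp: few_def)
    also have "\<dots> = Z N x - B N x"
      unfolding Z_eq B_def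
      by (intro Bochner_Integration.integral_diff integrable_contacts[where f="\<lambda>A. of_bool (few N A) * (\<Prod>n\<in>A. tilt (\<omega> n x))" and N=N]
        integrable_contacts[where f="\<lambda>A. \<Prod>n\<in>A. tilt (\<omega> n x)" and N=N])
    finally show ?thesis
      using pinning_probability[where P="\<lambda>A. real N powr \<gamma> < real (card A)" and N=N and x=x] Z_pos[of N x]
      by (simp add: R_def diff_divide_distrib)
  qed
  \<comment> \<open>An upper bound for the indicator of $Z < 1/k$; above that level \<open>R\<close> is at most \<open>k * B\<close>.\<close>
  let ?e = "\<lambda>k z. exp (1 - real k * z) :: real"
  have e_int: "integrable Q (\<lambda>x. ?e k (Z N x))" for k N
    using Z_pos[of N] supermartingale.Z_measurable[of N]
    by (intro env.integrable_const_bound[where B="exp 1"]) (auto simp: less_imp_le)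
  have R_bound: "(\<integral>x. R N x \<partial>Q) \<le> real k * p N + (\<integral>x. ?e k (Z N x) \<partial>Q)" for N k
  proof -
    have "R N x \<le> real k * B N x + ?e k (Z N x)" for x
    proof (cases "1 \<le> real k * Z N x")
      case True
      then have "1 / Z N x \<le> real k" using Z_pos[of N x] by (simp add: field_simps)
      then have "R N x \<le> real k * B N x"
        using mult_right_mono[OF _ B_nn[of N x], of "1 / Z N x" "real k"] by (simp add: R_def)
      then show ?thesis by (simp add: add_increasing2)
    next
      case False
      then have "1 \<le> ?e k (Z N x)" by simp
      moreover have "0 \<le> real k * B N x" using B_nn by simp
      ultimately show ?thesis using R_le1[of N x] by linarith
    qed
    then have "(\<integral>x. R N x \<partial>Q) \<le> (\<integral>x. real k * B N x + ?e k (Z N x) \<partial>Q)"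
      by (intro integral_mono R_int Bochner_Integration.integrable_add integrable_mult_right B_int e_int)
    also have "\<dots> = real k * p N + (\<integral>x. ?e k (Z N x) \<partial>Q)"
      using B_int e_int by (simp add: B_mean)
    finally show ?thesis .
  qed
  have e_lim: "(\<lambda>N. \<integral>x. ?e k (Z N x) \<partial>Q) \<longlonglongrightarrow> (\<integral>x. ?e k (Z_lim x) \<partial>Q)" for k
  proof (rule integral_dominated_convergence[where w="\<lambda>_. exp 1"])
    show "AE x in Q. (\<lambda>N. ?e k (Z N x)) \<longlonglongrightarrow> ?e k (Z_lim x)"
      using AE_tendsto_Z_lim by eventually_elim (intro tendsto_intros)
    show "AE x in Q. norm (?e k (Z N x)) \<le> exp 1" for N
      using Z_pos by (intro AE_I2) (simp add: less_imp_le)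
    show "(\<lambda>x. ?e k (Z N x)) \<in> borel_measurable Q" for N
      using e_int by auto
  qed auto
  have e_small: "(\<lambda>k. \<integral>x. ?e k (Z_lim x) \<partial>Q) \<longlonglongrightarrow> (\<integral>x. 0 \<partial>Q)"
  proof (rule integral_dominated_convergence[where w="\<lambda>_. exp 1"])
    show "AE x in Q. (\<lambda>k. ?e k (Z_lim x)) \<longlonglongrightarrow> 0"
      using pos
    proof eventually_elim
      case (elim x)
      have "filterlim (\<lambda>k. - Z_lim x * real k) at_bot sequentially"
        using elim by (intro filterlim_tendsto_neg_mult_at_bot[OF tendsto_const] filterlim_real_sequentially) auto
      then have "(\<lambda>k. exp 1 * exp (- Z_lim x * real k)) \<longlonglongrightarrow> exp 1 * 0"
        by (intro tendsto_mult tendsto_const filterlim_compose[OF exp_at_bot])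
      then show ?case by (simp add: exp_add[symmetric] mult.commute)
    qed
    show "AE x in Q. norm (?e k (Z_lim x)) \<le> exp 1" for k
      using pos by eventually_elim simp
  qed auto
  have R_lim: "(\<lambda>N. \<integral>x. R N x \<partial>Q) \<longlonglongrightarrow> 0"
  proof (rule order_tendstoI)
    fix a :: real assume "a < 0"
    moreover have "0 \<le> (\<integral>x. R N x \<partial>Q)" for N using R_nn by (intro integral_nonneg_AE AE_I2)
    ultimately show "\<forall>\<^sub>F N in sequentially. a < (\<integral>x. R N x \<partial>Q)"
      by (intro always_eventually allI) (meson less_le_trans)
  next
    fix a :: real assume "0 < a"
    then have "\<forall>\<^sub>F k in sequentially. (\<integral>x. ?e k (Z_lim x) \<partial>Q) < a"
      using order_tendstoD(2)[OF e_small] by simp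
    then obtain k where k: "(\<integral>x. ?e k (Z_lim x) \<partial>Q) < a"
      by (auto simp: eventually_sequentially)
    have "(\<lambda>N. real k * p N + (\<integral>x. ?e k (Z N x) \<partial>Q)) \<longlonglongrightarrow> real k * 0 + (\<integral>x. ?e k (Z_lim x) \<partial>Q)"
      by (intro tendsto_add tendsto_mult tendsto_const p_lim e_lim)
    then have "\<forall>\<^sub>F N in sequentially. real k * p N + (\<integral>x. ?e k (Z N x) \<partial>Q) < a"
      using k by (intro order_tendstoD(2)) auto
    then show "\<forall>\<^sub>F N in sequentially. (\<integral>x. R N x \<partial>Q) < a"
      by eventually_elim (use R_bound[of _ k] in \<open>meson le_less_trans\<close>)
  qed
  have "(\<integral>x. 1 - R N x \<partial>Q) = 1 - (\<integral>x. R N x \<partial>Q)" for N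
    using R_int by (simp add: env.prob_space)
  moreover have "(\<lambda>N. 1 - (\<integral>x. R N x \<partial>Q)) \<longlonglongrightarrow> 1 - 0"
    by (intro tendsto_diff tendsto_const R_lim)
  ultimately show ?thesis unfolding prob_eq by simp
qed

end

theorem proposition1p5:
  fixes M :: "'a measure" and \<tau> :: "nat \<Rightarrow> 'a \<Rightarrow> nat" and \<alpha> :: real and L :: "real \<Rightarrow> real"
    and Q :: "'b measure" and \<omega> :: "nat \<Rightarrow> 'b \<Rightarrow> real" and \<beta> \<gamma> :: real
  assumes "renewal_process M \<tau> \<alpha> L"
    and "recurrent_renewal M \<tau>"
    and "environment Q \<omega>"
    and "\<beta> > 0"
    and "AE x in Q. limit_partition_function M \<tau> Q \<omega> \<beta> x > 0"
    and "\<gamma> < \<alpha>"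
  shows "(\<lambda>N. \<integral>x. measure (pinning_measure M \<tau> N \<beta> (- log_mgf Q \<omega> \<beta>) (\<lambda>n. \<omega> n x))
                    {y \<in> space M. real (card (renewal_set \<tau> y \<inter> {1..N})) > real N powr \<gamma>} \<partial>Q)
         \<longlonglongrightarrow> 1"
proof -
  interpret pinning_model M \<tau> \<alpha> L Q \<omega> \<beta>
    using assms by (simp add: pinning_model_def pinning_model_axioms_def)
  have pos: "AE x in Q. 0 < Z_lim x" using assms(5) by (simp add: Z_lim_def)
  \<comment> \<open>This gives \<open>\<gamma> < 1\<close>, without which the contacts could not outnumber \<open>N powr \<gamma>\<close>.\<close>
  have "\<alpha> \<le> 1/2"
  proof (rule ccontr)
    assume "\<not> \<alpha> \<le> 1/2"
    then have "AE x in Q. Z_lim x = 0" by (intro strong_disorder) simp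
    with pos have "AE x in Q. False" by eventually_elim simp
    then show False by simp
  qed
  then show ?thesis using many_contacts[OF pos assms(6)] assms(6) by (simp add: contacts_def)
qed

end
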